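(* Let $\Gamma\subset\mathsf{Homeo}(M)$ be a non-elementary convergence group and let $\sigma \colon \Gamma \times M \rightarrow \mathbb{R}$ be an expanding coarse-cocycle. Then $\sigma$ is coarsely-symmetric if and only if $$\sup_{\gamma \in \Gamma} \left|\|\gamma\|_\sigma - \|\gamma^{-1}\|_\sigma\right| < + \infty.$$ Moreover, if $\sigma$ is coarsely-symmetric, then $(\sigma, \sigma, G)$ is a coarse GPS system for $\Gamma$ acting on $\Lambda(\Gamma) \subset M$, where $G \colon \Lambda(\Gamma)^{(2)} \to \mathbb{R}$ is defined by $$G(x,y) = \limsup_{\alpha \to x,\, \beta \to y} \|\alpha\|_\sigma +\|\beta^{-1}\|_\sigma-\|\beta^{-1}\alpha\|_\sigma,$$ the limsup being over $\alpha,\beta\in\Gamma$ converging to $x,y$ in $\Gamma\sqcup M$.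
   Context: Coarsely-symmetric: a coarse-cocycle $\sigma$ is coarsely-symmetric if $\sup|\sigma(\gamma,\gamma^+)-\sigma(\gamma^{-1},\gamma^-)|<+\infty$, the supremum over all loxodromic $\gamma\in\Gamma$. Convergence groups. $M$ is a compact metrizable space. A subgroup $\Gamma\subset\mathsf{Homeo}(M)$ is a (discrete) convergence group if for every sequence $\{\gamma_n\}$ of distinct elements of $\Gamma$ there are $x,y\in M$ and a subsequence $\{\gamma_{n_j}\}$ such that $\gamma_{n_j}|_{M\smallsetminus\{y\}}$ converges locally uniformly to the constant $x$. The limit set $\Lambda(\Gamma)$ is the set of $x\in M$ for which there are $y\in M$ and a sequence $\{\gamma_n\}\subset\Gamma$ with $\gamma_n|_{M\smallsetminus\{y\}}\to x$ locally uniformly. $\Gamma$ is non-elementary if $\#\Lambda(\Gamma)\ge 3$. An element $\gamma$ is loxodromic if it has two fixed points $\gamma^+\ne\gamma^-$ in $\Lambda(\Gamma)$ such that $\gamma^{\pm n}|_{M\smallsetminus\{\gamma^{\mp}\}}$ converges locally uniformly to $\gamma^{\pm}$ as $n\to+\infty$. For a set $A$, $A^{(2)}=\{(x,y)\in A^2:x\ne y\}$. Compatible metrics. $\Gamma\sqcup M$ carries a unique compact metrizable topology for which the inclusions of $\Gamma$ (discrete) and of $M$ are embeddings and the natural action of $\Gamma$ (left multiplication on $\Gamma$) is a convergence group action. A compatible metric $\mathrm{d}$ is a metric on $\Gamma\sqcup M$ inducing this topology; fix one. Coarse-cocycles. For $\kappa\ge0$, $\sigma\colon\Gamma\times M\to\mathbb{R}$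 is a $\kappa$-coarse-cocycle if (i) $\limsup_{x\to x_0}|\sigma(\gamma,x_0)-\sigma(\gamma,x)|\le\kappa$ for all $\gamma\in\Gamma$, $x_0\in M$, and (ii) $|\sigma(\gamma_1\gamma_2,x)-(\sigma(\gamma_1,\gamma_2x)+\sigma(\gamma_2,x))|\le\kappa$ for all $\gamma_1,\gamma_2\in\Gamma$, $x\in M$. A coarse-cocycle is a $\kappa$-coarse-cocycle for some $\kappa$. It is proper if $\sigma(\gamma_n,\gamma_n^+)\to+\infty$ whenever $\{\gamma_n\}\subset\Gamma$ is a sequence of distinct loxodromic elements with $\liminf_n\mathrm{d}(\gamma_n^-,\gamma_n^+)>0$. It is expanding if it is proper and for each $\gamma\in\Gamma$ there is a number $\|\gamma\|_\sigma\in\mathbb{R}$ (the $\sigma$-magnitude) such that for every $\epsilon>0$ there is $C>0$ with $\|\gamma\|_\sigma-C\le\sigma(\gamma,x)\le\|\gamma\|_\sigma+C$ whenever $x\in M$, $\gamma\in\Gamma$ and $\mathrm{d}(x,\gamma^{-1})>\epsilon$ (here $\gamma^{-1}$ is a point of $\Gamma\sqcup M$). The magnitude function is any fixed choice; two choices differ by a bounded amount. GPS systems. For $\Gamma$ acting on $N=\Lambda(\Gamma)$ (with the cocycles restricted to $\Gamma\times N$), $(\sigma,\bar\sigma,G)$ is a coarse GPS system if for some $\kappa\ge0$: $\sigma,\bar\sigma\colon\Gamma\times N\to\mathbb{R}$ are proper $\kappa$-coarse-cocycles, $G\colon N^{(2)}\to\mathbb{R}$ is locally bounded, and $|(\bar\sigma(\gamma,x)+\sigma(\gamma,y))-(G(\gamma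 x,\gamma y)-G(x,y))|\le\kappa$ for all $\gamma\in\Gamma$ and distinct $x,y\in N$. *)

theory Defs
  imports "HOL-Analysis.Analysis"
begin

text \<open>
  The space \<open>M\<close> is the type \<open>'a\<close>. A subgroup of \<open>Homeo(M)\<close> is a set \<open>\<Gamma>\<close> of functions \<open>'a \<Rightarrow> 'a\<close>,
  with \<open>\<circ>\<close> as product, \<open>inv\<close> as inverse and \<open>\<gamma> ^^ n\<close> as power. Cocycles and magnitudes are total
  functions whose values outside \<open>\<Gamma>\<close> (and outside the relevant part of \<open>M\<close>) are never used.
\<close>

section \<open>Convergence groups\<close>

text \<open>
  Locally uniform convergence of \<open>f n\<close>, restricted to the complement of \<open>y\<close>, to the constant \<open>x\<close>.
  As the limit is constant, uniform convergence on \<open>U - {y}\<close> for a metric inducing \<open>X\<close> says exactly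
  that every neighbourhood of \<open>x\<close> eventually contains \<open>f n ` (U - {y})\<close>.
\<close>

definition conv_loc_unif_off :: "'x topology \<Rightarrow> (nat \<Rightarrow> 'x \<Rightarrow> 'x) \<Rightarrow> 'x \<Rightarrow> 'x \<Rightarrow> bool" where
  "conv_loc_unif_off X f y x \<longleftrightarrow>
     (\<forall>p \<in> topspace X - {y}. \<exists>U. openin X U \<and> p \<in> U \<and>
        (\<forall>V. openin X V \<and> x \<in> V \<longrightarrow> (\<forall>\<^sub>F n in sequentially. f n ` (U - {y}) \<subseteq> V)))"

text \<open>
  The action laws for \<open>act\<close> are not included; they are immediate for the two actions considered
  below.
\<close>

definition acts_as_convergence_group ::
    "'x topology \<Rightarrow> 'g set \<Rightarrow> ('g \<Rightarrow> 'x \<Rightarrow> 'x) \<Rightarrow> bool" where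
  "acts_as_convergence_group X \<Gamma> act \<longleftrightarrow>
     (\<forall>\<gamma>\<in>\<Gamma>. homeomorphic_map X X (act \<gamma>)) \<and>
     (\<forall>g :: nat \<Rightarrow> 'g. inj g \<and> range g \<subseteq> \<Gamma> \<longrightarrow>
        (\<exists>x \<in> topspace X. \<exists>y \<in> topspace X. \<exists>r :: nat \<Rightarrow> nat. strict_mono r \<and>
           conv_loc_unif_off X (\<lambda>j. act (g (r j))) y x))"

definition convergence_group :: "('a::topological_space \<Rightarrow> 'a) set \<Rightarrow> bool" where
  "convergence_group \<Gamma> \<longleftrightarrow>
     id \<in> \<Gamma> \<and> (\<forall>\<alpha>\<in>\<Gamma>. \<forall>\<beta>\<in>\<Gamma>. \<alpha> \<circ> \<beta> \<in> \<Gamma>) \<and> (\<forall>\<alpha>\<in>\<Gamma>. inv \<alpha> \<in> \<Gamma>) \<and>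
     acts_as_convergence_group euclidean \<Gamma> (\<lambda>\<gamma>. \<gamma>)"

definition limit_set :: "('a::topological_space \<Rightarrow> 'a) set \<Rightarrow> 'a set" where
  "limit_set \<Gamma> = {x. \<exists>y. \<exists>g :: nat \<Rightarrow> 'a \<Rightarrow> 'a. range g \<subseteq> \<Gamma> \<and> conv_loc_unif_off euclidean g y x}"

definition non_elementary :: "('a::topological_space \<Rightarrow> 'a) set \<Rightarrow> bool" where
  "non_elementary \<Gamma> \<longleftrightarrow> infinite (limit_set \<Gamma>) \<or> card (limit_set \<Gamma>) \<ge> 3"

text \<open>
  \<open>loxodromic_with \<Gamma> \<gamma> p q\<close> says that \<open>\<gamma>\<close> is loxodromic with \<open>\<gamma>\<^sup>+ = p\<close> and \<open>\<gamma>\<^sup>- = q\<close>. These points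
  are determined by \<open>\<gamma>\<close> as soon as \<open>M\<close> is Hausdorff with at least three points.
\<close>

definition loxodromic_with ::
    "('a::topological_space \<Rightarrow> 'a) set \<Rightarrow> ('a \<Rightarrow> 'a) \<Rightarrow> 'a \<Rightarrow> 'a \<Rightarrow> bool" where
  "loxodromic_with \<Gamma> \<gamma> p q \<longleftrightarrow>
     \<gamma> \<in> \<Gamma> \<and> p \<in> limit_set \<Gamma> \<and> q \<in> limit_set \<Gamma> \<and> p \<noteq> q \<and> \<gamma> p = p \<and> \<gamma> q = q \<and>
     conv_loc_unif_off euclidean (\<lambda>n. \<gamma> ^^ n) q p \<and>
     conv_loc_unif_off euclidean (\<lambda>n. inv \<gamma> ^^ n) p q"


section \<open>The compactification of \<open>\<Gamma>\<close> by \<open>M\<close>\<close>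

definition bordification :: "('a \<Rightarrow> 'a) set \<Rightarrow> (('a \<Rightarrow> 'a) + 'a) set" where
  "bordification \<Gamma> = \<Gamma> <+> (UNIV :: 'a set)"

definition bord_act :: "('a \<Rightarrow> 'a) \<Rightarrow> ('a \<Rightarrow> 'a) + 'a \<Rightarrow> ('a \<Rightarrow> 'a) + 'a" where
  "bord_act \<gamma> = map_sum (\<lambda>\<alpha>. \<gamma> \<circ> \<alpha>) \<gamma>"

definition bord_topology ::
    "('a::topological_space \<Rightarrow> 'a) set \<Rightarrow> (('a \<Rightarrow> 'a) + 'a) topology \<Rightarrow> bool" where
  "bord_topology \<Gamma> T \<longleftrightarrow>
     topspace T = bordification \<Gamma> \<and> compact_space T \<and> metrizable_space T \<and>
     embedding_map (discrete_topology \<Gamma>) T Inl \<and>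
     embedding_map euclidean T Inr \<and>
     acts_as_convergence_group T \<Gamma> bord_act"

definition compatible_metric ::
    "('a::topological_space \<Rightarrow> 'a) set \<Rightarrow> (('a \<Rightarrow> 'a) + 'a \<Rightarrow> ('a \<Rightarrow> 'a) + 'a \<Rightarrow> real) \<Rightarrow> bool" where
  "compatible_metric \<Gamma> d \<longleftrightarrow>
     Metric_space (bordification \<Gamma>) d \<and>
     bord_topology \<Gamma> (Metric_space.mtopology (bordification \<Gamma>) d)"


section \<open>Coarse-cocycles\<close>

definition kappa_coarse_cocycle ::
    "real \<Rightarrow> ('a::topological_space \<Rightarrow> 'a) set \<Rightarrow> 'a set \<Rightarrow> (('a \<Rightarrow> 'a) \<Rightarrow> 'a \<Rightarrow> real) \<Rightarrow> bool" where
  "kappa_coarse_cocycle \<kappa> \<Gamma> N \<sigma> \<longleftrightarrow>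
     \<kappa> \<ge> 0 \<and>
     (\<forall>\<gamma>\<in>\<Gamma>. \<forall>x\<^sub>0\<in>N. Limsup (at x\<^sub>0 within N) (\<lambda>x. ereal \<bar>\<sigma> \<gamma> x\<^sub>0 - \<sigma> \<gamma> x\<bar>) \<le> ereal \<kappa>) \<and>
     (\<forall>\<gamma>\<^sub>1\<in>\<Gamma>. \<forall>\<gamma>\<^sub>2\<in>\<Gamma>. \<forall>x\<in>N. \<bar>\<sigma> (\<gamma>\<^sub>1 \<circ> \<gamma>\<^sub>2) x - (\<sigma> \<gamma>\<^sub>1 (\<gamma>\<^sub>2 x) + \<sigma> \<gamma>\<^sub>2 x)\<bar> \<le> \<kappa>)"

definition coarse_cocycle ::
    "('a::topological_space \<Rightarrow> 'a) set \<Rightarrow> 'a set \<Rightarrow> (('a \<Rightarrow> 'a) \<Rightarrow> 'a \<Rightarrow> real) \<Rightarrow> bool" where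
  "coarse_cocycle \<Gamma> N \<sigma> \<longleftrightarrow> (\<exists>\<kappa>. kappa_coarse_cocycle \<kappa> \<Gamma> N \<sigma>)"

text \<open>
  Properness only involves the values of \<open>\<sigma>\<close> on the limit set, so it needs no separate version for
  cocycles restricted to the limit set.
\<close>

definition proper_cocycle ::
    "('a::topological_space \<Rightarrow> 'a) set \<Rightarrow> (('a \<Rightarrow> 'a) + 'a \<Rightarrow> ('a \<Rightarrow> 'a) + 'a \<Rightarrow> real) \<Rightarrow>
     (('a \<Rightarrow> 'a) \<Rightarrow> 'a \<Rightarrow> real) \<Rightarrow> bool" where
  "proper_cocycle \<Gamma> d \<sigma> \<longleftrightarrow>
     (\<forall>(g :: nat \<Rightarrow> 'a \<Rightarrow> 'a) p q.
        inj g \<and> (\<forall>n. loxodromic_with \<Gamma> (g n) (p n) (q n)) \<and>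
        liminf (\<lambda>n. ereal (d (Inr (q n)) (Inr (p n)))) > 0 \<longrightarrow>
        filterlim (\<lambda>n. \<sigma> (g n) (p n)) at_top sequentially)"

definition magnitude ::
    "('a \<Rightarrow> 'a) set \<Rightarrow> (('a \<Rightarrow> 'a) + 'a \<Rightarrow> ('a \<Rightarrow> 'a) + 'a \<Rightarrow> real) \<Rightarrow>
     (('a \<Rightarrow> 'a) \<Rightarrow> 'a \<Rightarrow> real) \<Rightarrow> (('a \<Rightarrow> 'a) \<Rightarrow> real) \<Rightarrow> bool" where
  "magnitude \<Gamma> d \<sigma> m \<longleftrightarrow>
     (\<forall>\<epsilon>>0. \<exists>C>0. \<forall>x. \<forall>\<gamma>\<in>\<Gamma>. d (Inr x) (Inl (inv \<gamma>)) > \<epsilon> \<longrightarrow>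
        m \<gamma> - C \<le> \<sigma> \<gamma> x \<and> \<sigma> \<gamma> x \<le> m \<gamma> + C)"

definition expanding_coarse_cocycle ::
    "('a::topological_space \<Rightarrow> 'a) set \<Rightarrow> (('a \<Rightarrow> 'a) + 'a \<Rightarrow> ('a \<Rightarrow> 'a) + 'a \<Rightarrow> real) \<Rightarrow>
     (('a \<Rightarrow> 'a) \<Rightarrow> 'a \<Rightarrow> real) \<Rightarrow> bool" where
  "expanding_coarse_cocycle \<Gamma> d \<sigma> \<longleftrightarrow>
     coarse_cocycle \<Gamma> UNIV \<sigma> \<and> proper_cocycle \<Gamma> d \<sigma> \<and> (\<exists>m. magnitude \<Gamma> d \<sigma> m)"

definition coarsely_symmetric ::
    "('a::topological_space \<Rightarrow> 'a) set \<Rightarrow> (('a \<Rightarrow> 'a) \<Rightarrow> 'a \<Rightarrow> real) \<Rightarrow> bool" where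
  "coarsely_symmetric \<Gamma> \<sigma> \<longleftrightarrow>
     bdd_above {\<bar>\<sigma> \<gamma> p - \<sigma> (inv \<gamma>) q\<bar> | \<gamma> p q. loxodromic_with \<Gamma> \<gamma> p q}"


section \<open>Coarse GPS systems\<close>

definition distinct_pairs :: "'a set \<Rightarrow> ('a \<times> 'a) set" where
  "distinct_pairs A = {(x, y). x \<in> A \<and> y \<in> A \<and> x \<noteq> y}"

definition locally_bounded_on :: "'b::topological_space set \<Rightarrow> ('b \<Rightarrow> real) \<Rightarrow> bool" where
  "locally_bounded_on S f \<longleftrightarrow>
     (\<forall>p\<in>S. \<exists>U. openin (top_of_set S) U \<and> p \<in> U \<and> bounded (f ` U))"

text \<open>A coarse GPS system for \<open>\<Gamma>\<close> acting on its limit set.\<close>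

definition coarse_GPS_system ::
    "('a::topological_space \<Rightarrow> 'a) set \<Rightarrow> (('a \<Rightarrow> 'a) + 'a \<Rightarrow> ('a \<Rightarrow> 'a) + 'a \<Rightarrow> real) \<Rightarrow>
     (('a \<Rightarrow> 'a) \<Rightarrow> 'a \<Rightarrow> real) \<Rightarrow> (('a \<Rightarrow> 'a) \<Rightarrow> 'a \<Rightarrow> real) \<Rightarrow> ('a \<times> 'a \<Rightarrow> real) \<Rightarrow> bool" where
  "coarse_GPS_system \<Gamma> d \<sigma> \<sigma>' G \<longleftrightarrow>
     (\<exists>\<kappa>\<ge>0.
        kappa_coarse_cocycle \<kappa> \<Gamma> (limit_set \<Gamma>) \<sigma> \<and> proper_cocycle \<Gamma> d \<sigma> \<and>
        kappa_coarse_cocycle \<kappa> \<Gamma> (limit_set \<Gamma>) \<sigma>' \<and> proper_cocycle \<Gamma> d \<sigma>' \<and>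
        locally_bounded_on (distinct_pairs (limit_set \<Gamma>)) G \<and>
        (\<forall>\<gamma>\<in>\<Gamma>. \<forall>(x, y) \<in> distinct_pairs (limit_set \<Gamma>).
           \<bar>(\<sigma>' \<gamma> x + \<sigma> \<gamma> y) - (G (\<gamma> x, \<gamma> y) - G (x, y))\<bar> \<le> \<kappa>))"

definition tending_to ::
    "('a \<Rightarrow> 'a) set \<Rightarrow> (('a \<Rightarrow> 'a) + 'a \<Rightarrow> ('a \<Rightarrow> 'a) + 'a \<Rightarrow> real) \<Rightarrow> 'a \<Rightarrow> ('a \<Rightarrow> 'a) filter" where
  "tending_to \<Gamma> d x =
     filtercomap Inl
       (atin_within (Metric_space.mtopology (bordification \<Gamma>) d) (Inr x) (Inl ` \<Gamma>))"

text \<open>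
  The limsup defining \<open>G(x, y)\<close> for the magnitude \<open>m\<close>, a priori an extended real.
\<close>

definition gromov_limsup ::
    "('a \<Rightarrow> 'a) set \<Rightarrow> (('a \<Rightarrow> 'a) + 'a \<Rightarrow> ('a \<Rightarrow> 'a) + 'a \<Rightarrow> real) \<Rightarrow>
     (('a \<Rightarrow> 'a) \<Rightarrow> real) \<Rightarrow> 'a \<times> 'a \<Rightarrow> ereal" where
  "gromov_limsup \<Gamma> d m = (\<lambda>(x, y).
     Limsup (tending_to \<Gamma> d x \<times>\<^sub>F tending_to \<Gamma> d y)
       (\<lambda>(\<alpha>, \<beta>). ereal (m \<alpha> + m (inv \<beta>) - m (inv \<beta> \<circ> \<alpha>))))"

end

(*
  Let |g| be the magnitude. The convergence property says that all but finitely many g send the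
  complement of the eps-ball about g^-1 into the eps-ball about g. Hence g is loxodromic, with g+
  near g and g- near g^-1, as soon as g and g^-1 are well separated, and then sigma(g, g+) is
  boundedly close to |g|; this bounds | |g| - |g^-1| | when sigma is coarsely symmetric. When g and
  g^-1 accumulate at the same point x, replace g by f g with f moving x, which changes |g| and
  |g^-1| by a bounded amount. Conversely sigma(g, g+) is, up to kappa, the limit of |g^n|/n.
  For the GPS identity, |ga| - |a| is boundedly close to sigma(g, x) as a tends to x, and
  |a| + |b^-1| - |b^-1 a| is bounded when a and b are separated.
*)
theory Submission
  imports Defs
begin

text \<open>The element \<open>f\<close> moving \<open>x\<close> is the delicate point:
  \<open>\<Gamma>\<close> must have no global fixed point, and this is derived from properness. If
  \<open>\<Gamma>\<close> fixed \<open>q\<close>, then \<sigma>(., q) would be a quasimorphism on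
  \<open>\<Gamma>\<close>, hence bounded on commutators. Properness, however, leaves only finitely
  many \<open>h\<close> with \<sigma>(h, q) bounded that send some point away from \<open>q\<close>
  to a point away from \<open>q\<close>. Commutators with powers of a loxodromic element supply too
  many of these.

  Magnitudes of products are always compared in the same way: the cocycle identity is evaluated at a
  test point \<open>z\<close> of M that is far from the inverses of the elements involved. Such a
  \<open>z\<close> exists at a scale independent of these elements, because each inverse is close to
  at most one of three fixed points of M.

  In the GPS identity, \<sigma> measures the effect of left multiplication only, whereas the term
  |b^-1| undergoes right multiplication by the inverse of \<gamma>. Symmetry of the magnitude is
  what turns one into the other.\<close>

locale bordified_convergence_group =
  fixes \<Gamma> :: "('a::metric_space \<Rightarrow> 'a) set"
    and d :: "('a \<Rightarrow> 'a) + 'a \<Rightarrow> ('a \<Rightarrow> 'a) + 'a \<Rightarrow> real"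
  assumes compact_M: "compact (UNIV :: 'a set)"
    and convergence: "convergence_group \<Gamma>"
    and compatible: "compatible_metric \<Gamma> d"
    and nonelementary: "non_elementary \<Gamma>"
begin

abbreviation B :: "(('a \<Rightarrow> 'a) + 'a) set" where "B \<equiv> bordification \<Gamma>"

abbreviation X :: "(('a \<Rightarrow> 'a) + 'a) topology" where "X \<equiv> Metric_space.mtopology B d"

sublocale Metric_space B d
  using compatible unfolding compatible_metric_def by blast

section \<open>Group laws in \<open>\<Gamma>\<close> and the topology of the
  compactification\<close>

lemma bord: "bord_topology \<Gamma> X"
  using compatible unfolding compatible_metric_def by blast

lemma Inr_in_B [simp]: "Inr x \<in> B"
  and Inl_in_B [simp]: "Inl \<alpha> \<in> B \<longleftrightarrow> \<alpha> \<in> \<Gamma>"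
  by (auto simp: bordification_def)

lemma id_in [simp]: "id \<in> \<Gamma>"
  and comp_in [simp]: "\<alpha> \<in> \<Gamma> \<Longrightarrow> \<beta> \<in> \<Gamma> \<Longrightarrow> \<alpha> \<circ> \<beta> \<in> \<Gamma>"
  and inv_in [simp]: "\<alpha> \<in> \<Gamma> \<Longrightarrow> inv \<alpha> \<in> \<Gamma>"
  using convergence unfolding convergence_group_def by auto

lemma bij_element: "\<alpha> \<in> \<Gamma> \<Longrightarrow> bij \<alpha>"
  using convergence homeomorphic_imp_injective_map homeomorphic_imp_surjective_map
  unfolding convergence_group_def acts_as_convergence_group_def bij_def
  by (metis topspace_euclidean)

lemma inv_inv [simp]: "\<alpha> \<in> \<Gamma> \<Longrightarrow> inv (inv \<alpha>) = \<alpha>"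
  using bij_element inv_inv_eq by blast

lemma inv_comp: "\<alpha> \<in> \<Gamma> \<Longrightarrow> \<beta> \<in> \<Gamma> \<Longrightarrow> inv (\<alpha> \<circ> \<beta>) = inv \<beta> \<circ> inv \<alpha>"
  using bij_element o_inv_distrib by blast

lemma inv_left [simp]: "\<alpha> \<in> \<Gamma> \<Longrightarrow> inv \<alpha> (\<alpha> x) = x"
  and inv_right [simp]: "\<alpha> \<in> \<Gamma> \<Longrightarrow> \<alpha> (inv \<alpha> x) = x"
  using bij_element by (simp_all add: bij_is_inj bij_is_surj surj_f_inv_f)

lemma inv_o [simp]: "\<alpha> \<in> \<Gamma> \<Longrightarrow> inv \<alpha> \<circ> \<alpha> = id" "\<alpha> \<in> \<Gamma> \<Longrightarrow> \<alpha> \<circ> inv \<alpha> = id"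
  by auto

lemma inv_o_cancel [simp]: "\<alpha> \<in> \<Gamma> \<Longrightarrow> inv \<alpha> \<circ> (\<alpha> \<circ> \<beta>) = \<beta>" "\<alpha> \<in> \<Gamma> \<Longrightarrow> \<alpha> \<circ> (inv \<alpha> \<circ> \<beta>) = \<beta>"
  by auto

lemma pow_in [simp]: "\<alpha> \<in> \<Gamma> \<Longrightarrow> \<alpha> ^^ n \<in> \<Gamma>"
  by (induction n) auto

lemma inv_pow: "\<alpha> \<in> \<Gamma> \<Longrightarrow> inv (\<alpha> ^^ n) = inv \<alpha> ^^ n"
  using inv_fn bij_element by blast

lemma act_simps [simp]: "bord_act \<gamma> (Inl \<alpha>) = Inl (\<gamma> \<circ> \<alpha>)" "bord_act \<gamma> (Inr x) = Inr (\<gamma> x)"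
  by (auto simp: bord_act_def)

lemma act_in_B: "\<gamma> \<in> \<Gamma> \<Longrightarrow> z \<in> B \<Longrightarrow> bord_act \<gamma> z \<in> B"
  by (cases z) auto

lemma act_continuous: "\<gamma> \<in> \<Gamma> \<Longrightarrow> continuous_map X X (bord_act \<gamma>)"
  using bord unfolding bord_topology_def acts_as_convergence_group_def
  by (simp add: homeomorphic_imp_continuous_map)

lemma tends_act: "\<gamma> \<in> \<Gamma> \<Longrightarrow> limitin X s l sequentially \<Longrightarrow>
    limitin X (\<lambda>n. bord_act \<gamma> (s n)) (bord_act \<gamma> l) sequentially"
  using continuous_map_limit[OF act_continuous] by (fastforce simp: o_def)

lemma embed_Inr: "embedding_map euclidean X Inr"
  and embed_Inl: "embedding_map (discrete_topology \<Gamma>) X Inl"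
  using bord unfolding bord_topology_def by auto

lemma continuous_Inr: "continuous_map euclidean X Inr"
  using embed_Inr homeomorphic_imp_continuous_map continuous_map_into_fulltopology
  unfolding embedding_map_def by blast

lemma compact_B: "compact_space X"
  using bord unfolding bord_topology_def by auto

lemma closedin_range_Inr: "closedin X (range Inr)"
  using image_compactin[of euclidean UNIV X Inr] continuous_Inr compact_M
  by (simp add: compactin_imp_closedin Hausdorff_space_mtopology)

text \<open>Discreteness of \<open>\<Gamma>\<close> gives an open set of \<open>X\<close> meeting
  \<open>\<Gamma>\<close> only in \<alpha>; subtracting M, which is compact and hence closed, leaves
  the single point.\<close>

lemma isolated:
  assumes "\<alpha> \<in> \<Gamma>"
  obtains r where "r > 0" "\<And>z. z \<in> B \<Longrightarrow> z \<noteq> Inl \<alpha> \<Longrightarrow> d (Inl \<alpha>) z \<ge> r"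
proof -
  have "openin (subtopology X (Inl ` \<Gamma>)) (Inl ` {\<alpha>})"
    using embed_Inl assms homeomorphic_map_openness[of "discrete_topology \<Gamma>" _ Inl "{\<alpha>}"]
    unfolding embedding_map_def by auto
  then obtain U where U: "openin X U" "Inl ` {\<alpha>} = U \<inter> Inl ` \<Gamma>"
    unfolding openin_subtopology by auto
  have "openin X (U - range Inr)"
    using U(1) closedin_range_Inr by blast
  moreover have "Inl \<alpha> \<in> U - range Inr"
    using U(2) by auto
  ultimately obtain r where r: "r > 0" "mball (Inl \<alpha>) r \<subseteq> U - range Inr"
    using openin_mtopology by metis
  have "d (Inl \<alpha>) z \<ge> r" if z: "z \<in> B" "z \<noteq> Inl \<alpha>" for z
  proof (rule ccontr)
    assume "\<not> ?thesis"
    then have "z \<in> U - range Inr"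
      using r(2) z(1) assms by (meson Inl_in_B in_mball not_le subsetD)
    then show False
      using U(2) z by (cases z) auto
  qed
  then show ?thesis using that r(1) by blast
qed

lemma far_from_finite:
  assumes "finite F" "F \<subseteq> \<Gamma>"
  obtains r where "r > 0" "\<And>\<alpha> z. \<alpha> \<in> F \<Longrightarrow> z \<in> B \<Longrightarrow> z \<noteq> Inl \<alpha> \<Longrightarrow> d z (Inl \<alpha>) > r"
proof -
  have "\<exists>r>0. \<forall>\<alpha>\<in>F. \<forall>z\<in>B. z \<noteq> Inl \<alpha> \<longrightarrow> d z (Inl \<alpha>) > r"
    using assms
  proof (induction F rule: finite_induct)
    case empty
    then show ?case using zero_less_one by blast
  next
    case (insert \<alpha> F)
    then obtain r where r: "r > 0" "\<forall>\<alpha>\<in>F. \<forall>z\<in>B. z \<noteq> Inl \<alpha> \<longrightarrow> d z (Inl \<alpha>) > r"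
      by auto
    obtain s where s: "s > 0" "\<And>z. z \<in> B \<Longrightarrow> z \<noteq> Inl \<alpha> \<Longrightarrow> d (Inl \<alpha>) z \<ge> s"
      using isolated[of \<alpha>] insert.prems by auto
    have "\<forall>\<beta>\<in>insert \<alpha> F. \<forall>z\<in>B. z \<noteq> Inl \<beta> \<longrightarrow> d z (Inl \<beta>) > min r (s/2)"
    proof (intro ballI impI)
      fix \<beta> z assume *: "\<beta> \<in> insert \<alpha> F" "z \<in> B" "z \<noteq> Inl \<beta>"
      show "d z (Inl \<beta>) > min r (s/2)"
      proof (cases "\<beta> \<in> F")
        case True
        then show ?thesis using r * by fastforce
      next
        case False
        then have "\<beta> = \<alpha>" using * by auto
        then have "d z (Inl \<beta>) \<ge> s" using s(2)[of z] * by (metis commute)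
        then show ?thesis using s(1) by linarith
      qed
    qed
    moreover have "min r (s/2) > 0" using r(1) s(1) by auto
    ultimately show ?case by blast
  qed
  then show ?thesis using that by blast
qed

lemma tends_metric:
  "limitin X s l sequentially \<longleftrightarrow> l \<in> B \<and> (\<forall>\<epsilon>>0. \<forall>\<^sub>F n in sequentially. s n \<in> B \<and> d (s n) l < \<epsilon>)"
  by (rule limitin_metric)

lemma tends_D: "limitin X s l sequentially \<Longrightarrow> \<epsilon> > 0 \<Longrightarrow> \<forall>\<^sub>F n in sequentially. d (s n) l < \<epsilon>"
  unfolding tends_metric by (auto elim: eventually_mono)

lemma tends_subseq: "limitin X s l sequentially \<Longrightarrow> strict_mono r \<Longrightarrow>
    limitin X (\<lambda>n. s (r n)) l sequentially"
  using limitin_subsequence[of r X s l] by (simp add: o_def)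

lemma convergent_subsequence:
  fixes s :: "nat \<Rightarrow> ('a \<Rightarrow> 'a) + 'a"
  assumes "\<And>n. s n \<in> B"
  obtains l r where "l \<in> B" "strict_mono r" "limitin X (\<lambda>n. s (r n)) l sequentially"
proof -
  have "compactin X B" using compact_B by (simp add: compact_space_def)
  moreover have "range s \<subseteq> B" using assms by auto
  ultimately obtain l r where "l \<in> B" "strict_mono r" "limitin X (s \<circ> r) l sequentially"
    unfolding compactin_sequentially by meson
  then show ?thesis using that by (simp add: o_def)
qed

lemma limit_of_distinct:
  assumes "inj g" "range g \<subseteq> \<Gamma>" "limitin X (\<lambda>n. Inl (g n)) l sequentially"
  obtains x where "l = Inr x"
proof (cases l)
  case (Inl \<alpha>)
  then have "\<alpha> \<in> \<Gamma>" using assms(3) by (simp add: tends_metric)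
  then obtain r where r: "r > 0" "\<And>z. z \<in> B \<Longrightarrow> z \<noteq> Inl \<alpha> \<Longrightarrow> d (Inl \<alpha>) z \<ge> r"
    using isolated by blast
  have "\<forall>\<^sub>F n in sequentially. g n = \<alpha>"
    using tends_D[OF assms(3) r(1)]
  proof eventually_elim
    case (elim n)
    then show ?case using r(2)[of "Inl (g n)"] assms(2) Inl commute[of l "Inl (g n)"] by fastforce
  qed
  then obtain N where "\<forall>n\<ge>N. g n = \<alpha>" by (auto simp: eventually_sequentially)
  then have "g N = g (Suc N)" by simp
  then show ?thesis using \<open>inj g\<close> by (metis injD n_not_Suc_n)
qed (use that in blast)

section \<open>Convergence dynamics on the compactification\<close>

lemma conv_loc_unif_offD:
  assumes "conv_loc_unif_off X f y x" "limitin X z w sequentially" "w \<noteq> y"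
    "x \<in> B" and f: "\<And>n u. u \<in> B \<Longrightarrow> f n u \<in> B"
  shows "limitin X (\<lambda>n. f n (z n)) x sequentially"
  unfolding limitin_def
proof (intro conjI allI impI)
  show "x \<in> topspace X" using assms by simp
  fix V assume V: "openin X V \<and> x \<in> V"
  have "w \<in> B" using assms(2) by (simp add: tends_metric)
  then obtain U where U: "openin X U" "w \<in> U"
     "\<forall>V. openin X V \<and> x \<in> V \<longrightarrow> (\<forall>\<^sub>F n in sequentially. f n ` (U - {y}) \<subseteq> V)"
    using assms(1,3) unfolding conv_loc_unif_off_def by auto
  \<comment> \<open>The estimate holds off \<open>y\<close>, so \<open>U - {y}\<close> must itself
    be shown to be a neighbourhood of \<open>w\<close> before the moving points \<open>z n\<close>
    can be fed into it.\<close>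
  have *: "\<forall>\<^sub>F n in sequentially. f n ` (U - {y}) \<subseteq> V" using U V by blast
  have "openin X (U - {y})"
  proof (cases "y \<in> B")
    case True
    then show ?thesis using U(1) t1_space_mtopology
      by (metis closedin_t1_singleton openin_diff topspace_mtopology)
  next
    case False
    then have "U - {y} = U" using openin_subset[OF U(1)] by auto
    then show ?thesis using U(1) by simp
  qed
  then have "\<forall>\<^sub>F n in sequentially. z n \<in> U - {y}"
    using assms(2,3) U(2) unfolding limitin_def by blast
  with * show "\<forall>\<^sub>F n in sequentially. f n (z n) \<in> V"
    by eventually_elim auto
qed

text \<open>The convergence property alone provides two points of the compactification. That they
  lie in M, and are the limits of the elements and of their inverses, comes from letting the maps
  act on points of \<open>\<Gamma>\<close>: on a fixed \<alpha>, on the inverses, and on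
  \<open>id\<close>.\<close>

lemma convergence_dynamics:
  fixes g :: "nat \<Rightarrow> 'a \<Rightarrow> 'a"
  assumes "inj g" "range g \<subseteq> \<Gamma>"
  obtains x y r where "strict_mono r"
    "limitin X (\<lambda>n. Inl (g (r n))) (Inr x) sequentially"
    "limitin X (\<lambda>n. Inl (inv (g (r n)))) (Inr y) sequentially"
    "\<forall>s z. limitin X s z sequentially \<longrightarrow> z \<noteq> Inr y \<longrightarrow>
      limitin X (\<lambda>n. bord_act (g (r n)) (s n)) (Inr x) sequentially"
proof -
  have g_in [simp]: "g n \<in> \<Gamma>" for n using assms(2) by auto
  obtain x y r where r: "x \<in> B" "y \<in> B" "strict_mono r"
    and conv: "conv_loc_unif_off X (\<lambda>j. bord_act (g (r j))) y x"
    using bord assms unfolding bord_topology_def acts_as_convergence_group_def topspace_mtopology by blast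
  have dyn: "limitin X (\<lambda>n. bord_act (g (r n)) (s n)) x sequentially"
    if "limitin X s z sequentially" "z \<noteq> y" for s z
    using conv_loc_unif_offD[OF conv that r(1)] by (simp add: act_in_B)
  have const: "limitin X (\<lambda>n. z) z sequentially" if "z \<in> B" for z
    using that by (simp add: limitin_const)
  \<comment> \<open>At this stage \<open>y\<close> may still be a point of \<open>\<Gamma>\<close>,
    but it cannot be both \<open>g 0\<close> and \<open>g 1\<close>.\<close>
  obtain \<alpha> where \<alpha>: "\<alpha> \<in> \<Gamma>" "Inl \<alpha> \<noteq> y"
  proof (cases "y = Inl (g 0)")
    case True
    then show ?thesis using that[of "g 1"] assms(1) by (auto simp: inj_eq)
  next
    case False
    then show ?thesis using that[of "g 0"] by auto
  qed
  have "limitin X (\<lambda>n. Inl (g (r n) \<circ> \<alpha>)) x sequentially"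
    using dyn[OF const[of "Inl \<alpha>"]] \<alpha> by simp
  moreover have "inj (\<lambda>n. g (r n) \<circ> \<alpha>)"
  proof (rule injI)
    fix m n assume "g (r m) \<circ> \<alpha> = g (r n) \<circ> \<alpha>"
    then have "g (r m) \<circ> \<alpha> \<circ> inv \<alpha> = g (r n) \<circ> \<alpha> \<circ> inv \<alpha>" by simp
    then have "g (r m) = g (r n)" using \<alpha>(1) by (simp add: comp_assoc)
    then show "m = n" using assms(1) r(3) by (simp add: inj_eq strict_mono_eq)
  qed
  ultimately obtain x' where x': "x = Inr x'"
    using limit_of_distinct[of "\<lambda>n. g (r n) \<circ> \<alpha>" x] \<alpha>(1) by (metis comp_in g_in image_subsetI)
  obtain w r' where r': "w \<in> B" "strict_mono r'" "limitin X (\<lambda>n. Inl (inv (g (r (r' n))))) w sequentially"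
    using convergent_subsequence[of "\<lambda>n. Inl (inv (g (r n)))"] by auto
  have dyn': "limitin X (\<lambda>n. bord_act (g (r (r' n))) (s n)) x sequentially"
    if "limitin X s z sequentially" "z \<noteq> y" for s z
  proof -
    have "conv_loc_unif_off X (\<lambda>j. bord_act (g (r (r' j)))) y x"
      unfolding conv_loc_unif_off_def
    proof
      fix p assume "p \<in> topspace X - {y}"
      then obtain U where U: "openin X U \<and> p \<in> U \<and>
        (\<forall>V. openin X V \<and> x \<in> V \<longrightarrow> (\<forall>\<^sub>F n in sequentially. bord_act (g (r n)) ` (U - {y}) \<subseteq> V))"
        using conv unfolding conv_loc_unif_off_def by blast
      then show "\<exists>U. openin X U \<and> p \<in> U \<and>
        (\<forall>V. openin X V \<and> x \<in> V \<longrightarrow> (\<forall>\<^sub>F n in sequentially. bord_act (g (r (r' n))) ` (U - {y}) \<subseteq> V))"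
        using eventually_subseq[OF r'(2)] by blast
    qed
    then show ?thesis
      using conv_loc_unif_offD[where f = "\<lambda>n. bord_act (g (r (r' n)))", OF _ that r(1)] by (simp add: act_in_B)
  qed
  \<comment> \<open>If the inverses accumulated off \<open>y\<close>, the maps applied to them would
    tend to \<open>x\<close>; but they give the constant \<open>id\<close>, while \<open>x\<close>
    lies in M.\<close>
  have "w = y"
  proof (rule ccontr)
    assume "w \<noteq> y"
    from dyn'[OF r'(3) this] have "limitin X (\<lambda>n. Inl id) x sequentially" by simp
    moreover have "limitin X (\<lambda>n. Inl id) (Inl id) sequentially" using const by simp
    ultimately have "x = Inl id"
      using limitin_Hausdorff_unique[OF _ _ _ Hausdorff_space_mtopology] by (metis sequentially_bot)
    then show False using x' by simp
  qed
  have injs: "inj (\<lambda>n. inv (g (r (r' n))))"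
  proof (rule injI)
    fix m n assume "inv (g (r (r' m))) = inv (g (r (r' n)))"
    then have "g (r (r' m)) = g (r (r' n))" using inv_inv g_in by metis
    then show "m = n" using assms(1) r(3) r'(2) by (simp add: inj_eq strict_mono_eq)
  qed
  then obtain y' where y': "w = Inr y'"
    using limit_of_distinct[of "\<lambda>n. inv (g (r (r' n)))" w] r'(3) by (metis inv_in g_in image_subsetI)
  have "limitin X (\<lambda>n. Inl (g (r (r' n)))) x sequentially"
    using dyn'[OF const[of "Inl id"]] y' \<open>w = y\<close> by simp
  then have "limitin X (\<lambda>n. Inl (g (r (r' n)))) (Inr x') sequentially"
    "limitin X (\<lambda>n. Inl (inv (g (r (r' n))))) (Inr y') sequentially"
    using x' y' r'(3) by auto
  moreover have "strict_mono (\<lambda>n. r (r' n))"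
    using strict_mono_o[OF r(3) r'(2)] by (simp add: o_def)
  moreover have "\<forall>s z. limitin X s z sequentially \<longrightarrow> z \<noteq> Inr y' \<longrightarrow>
      limitin X (\<lambda>n. bord_act (g (r (r' n))) (s n)) (Inr x') sequentially"
    using dyn' x' y' \<open>w = y\<close> by blast
  ultimately show ?thesis
    using that[of "\<lambda>n. r (r' n)" x' y'] by blast
qed

text \<open>The elements violating the convergence estimate at scale \<epsilon>. Being finite in
  number, they are absorbed into constants or left behind by the tail of a sequence.\<close>

definition exceptional :: "real \<Rightarrow> ('a \<Rightarrow> 'a) set" where
  "exceptional \<epsilon> = {g \<in> \<Gamma>. \<exists>z\<in>B. \<epsilon> \<le> d z (Inl (inv g)) \<and> \<epsilon> \<le> d (bord_act g z) (Inl g)}"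

lemma exceptional_subset: "exceptional \<epsilon> \<subseteq> \<Gamma>"
  by (auto simp: exceptional_def)

lemma not_exceptional:
  "g \<in> \<Gamma> \<Longrightarrow> g \<notin> exceptional \<epsilon> \<Longrightarrow> z \<in> B \<Longrightarrow> \<epsilon> \<le> d z (Inl (inv g)) \<Longrightarrow> d (bord_act g z) (Inl g) < \<epsilon>"
  by (force simp: exceptional_def)

lemma not_exceptional':
  "g \<in> \<Gamma> \<Longrightarrow> g \<notin> exceptional \<epsilon> \<Longrightarrow> z \<in> B \<Longrightarrow> \<epsilon> \<le> d (bord_act g z) (Inl g) \<Longrightarrow> d z (Inl (inv g)) < \<epsilon>"
  using not_exceptional[of g \<epsilon> z] by linarith

text \<open>
  A quantitative form of the convergence property, with no subsequences: all but finitely many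
  \<open>g\<close> send the complement of the \<open>\<epsilon>\<close>-ball about \<open>g\<inverse>\<close> into the \<open>\<epsilon>\<close>-ball about \<open>g\<close>.
\<close>
lemma finite_exceptional:
  assumes "\<epsilon> > 0"
  shows "finite (exceptional \<epsilon>)"
proof (rule ccontr)
  assume "infinite (exceptional \<epsilon>)"
  then obtain g :: "nat \<Rightarrow> 'a \<Rightarrow> 'a" where g: "inj g" "range g \<subseteq> exceptional \<epsilon>"
    using infinite_countable_subset by blast
  then have "\<forall>n. \<exists>z\<in>B. \<epsilon> \<le> d z (Inl (inv (g n))) \<and> \<epsilon> \<le> d (bord_act (g n) z) (Inl (g n))"
    unfolding exceptional_def by blast
  then obtain z where z: "z n \<in> B" "\<epsilon> \<le> d (z n) (Inl (inv (g n)))"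
      "\<epsilon> \<le> d (bord_act (g n) (z n)) (Inl (g n))" for n
    by metis
  have gin [simp]: "g n \<in> \<Gamma>" for n using g(2) exceptional_subset by blast
  obtain x y r where r: "strict_mono r"
    "limitin X (\<lambda>n. Inl (g (r n))) (Inr x) sequentially"
    "limitin X (\<lambda>n. Inl (inv (g (r n)))) (Inr y) sequentially"
    and dyn: "\<forall>s z. limitin X s z sequentially \<longrightarrow> z \<noteq> Inr y \<longrightarrow>
      limitin X (\<lambda>n. bord_act (g (r n)) (s n)) (Inr x) sequentially"
    by (rule convergence_dynamics[OF g(1) order_trans[OF g(2) exceptional_subset]])
  obtain w r' where r': "w \<in> B" "strict_mono r'" "limitin X (\<lambda>n. z (r (r' n))) w sequentially"
    using convergent_subsequence[of "\<lambda>n. z (r n)"] z(1) by auto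
  have "w \<noteq> Inr y"
  proof
    assume w: "w = Inr y"
    have "\<forall>\<^sub>F n in sequentially. False"
      using tends_D[OF r'(3) half_gt_zero[OF assms]] tends_D[OF tends_subseq[OF r(3) r'(2)] half_gt_zero[OF assms]]
    proof eventually_elim
      case (elim n)
      then show ?case
        using z(2)[of "r (r' n)"] triangle[of "z (r (r' n))" "Inr y" "Inl (inv (g (r (r' n))))"] z(1)
          commute[of "Inr y"] w by force
    qed
    then show False by simp
  qed
  \<comment> \<open>The dynamics is known along \<open>r\<close>, but the points \<open>z\<close>
    converge only along the finer subsequence. Filling the gaps with the limit \<open>w\<close>
    gives a sequence converging along all of \<open>r\<close>.\<close>
  define s where "s n = (if n \<in> range r' then z (r n) else w)" for n
  have "limitin X s w sequentially"
    unfolding tends_metric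
  proof (intro conjI allI impI)
    fix e :: real assume "e > 0"
    then obtain N where N: "\<forall>n\<ge>N. d (z (r (r' n))) w < e"
      using tends_D[OF r'(3)] by (auto simp: eventually_sequentially)
    have "s n \<in> B \<and> d (s n) w < e" if "n \<ge> r' N" for n
    proof (cases "n \<in> range r'")
      case True
      then obtain k where k: "n = r' k" by blast
      then have "k \<ge> N" using that r'(2) by (simp add: strict_mono_less_eq)
      then show ?thesis using N k z(1) by (simp add: s_def)
    qed (use \<open>e > 0\<close> r'(1) in \<open>simp add: s_def\<close>)
    then show "\<forall>\<^sub>F n in sequentially. s n \<in> B \<and> d (s n) w < e"
      by (auto simp: eventually_sequentially)
  qed (rule r'(1))
  then have 1: "limitin X (\<lambda>n. bord_act (g (r n)) (s n)) (Inr x) sequentially"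
    using dyn \<open>w \<noteq> Inr y\<close> by blast
  have "\<forall>\<^sub>F n in sequentially. False"
    using tends_D[OF tends_subseq[OF 1 r'(2)] half_gt_zero[OF assms]]
       tends_D[OF tends_subseq[OF r(2) r'(2)] half_gt_zero[OF assms]]
  proof eventually_elim
    case (elim n)
    then have "d (bord_act (g (r (r' n))) (z (r (r' n)))) (Inr x) < \<epsilon>/2" by (simp add: s_def)
    then show ?case
      using elim(2) z(3)[of "r (r' n)"] z(1) act_in_B[OF gin[of "r (r' n)"] z(1)[of "r (r' n)"]]
        triangle[of "bord_act (g (r (r' n))) (z (r (r' n)))" "Inr x" "Inl (g (r (r' n)))"]
          commute[of "Inr x"] by force
  qed
  then show False by simp
qed


section \<open>Loxodromic elements\<close>

text \<open>The metric of the type \<open>'a\<close> and the restriction of \<open>d\<close> to M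
  share only their topology; this lemma and \<open>open_M\<close> translate between them.\<close>

lemma ball_M: "open {y. d (Inr y) (Inr x) < r}"
proof -
  have "openin euclidean {y \<in> topspace euclidean. Inr y \<in> mball (Inr x) r}"
    using openin_continuous_map_preimage[OF continuous_Inr openin_mball] by blast
  then show ?thesis by (simp add: commute)
qed

lemma open_M:
  assumes "open U" "x \<in> U"
  obtains r where "r > 0" "\<And>y. d (Inr y) (Inr x) < r \<Longrightarrow> y \<in> U"
proof -
  have "openin (subtopology X (range Inr)) (Inr ` U)"
    using embed_Inr homeomorphic_map_openness[of euclidean _ Inr U] assms(1)
    unfolding embedding_map_def by auto
  then obtain W where W: "openin X W" "Inr ` U = W \<inter> range Inr"
    unfolding openin_subtopology by auto
  then have "Inr x \<in> W" using assms(2) by auto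
  then obtain r where r: "r > 0" "mball (Inr x) r \<subseteq> W"
    using W(1) openin_mtopology by metis
  have "y \<in> U" if "d (Inr y) (Inr x) < r" for y
  proof -
    have "Inr y \<in> mball (Inr x) r" using that by (simp add: commute)
    then have "Inr y \<in> W \<inter> range Inr" using r(2) by auto
    then show ?thesis unfolding W(2)[symmetric] by auto
  qed
  then show ?thesis using that r(1) by blast
qed

lemma three_points:
  obtains a b c where "a \<in> limit_set \<Gamma>" "b \<in> limit_set \<Gamma>" "c \<in> limit_set \<Gamma>" "a \<noteq> b" "a \<noteq> c" "b \<noteq> c"
proof -
  have "\<exists>S. S \<subseteq> limit_set \<Gamma> \<and> card S = 3"
    using nonelementary infinite_arbitrarily_large obtain_subset_with_card_n
    unfolding non_elementary_def by metis
  then show ?thesis using that by (auto simp: card_3_iff)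
qed

lemma d_pos: "x \<in> B \<Longrightarrow> y \<in> B \<Longrightarrow> x \<noteq> y \<Longrightarrow> d x y > 0"
  using mdist_pos_less by blast

text \<open>Of three points, \<open>u\<close> can be close to at most one, and \<open>v\<close> can
  be close to the image of at most one, so a third survives. The scale depends on \<open>h\<close>
  but not on \<open>u\<close> and \<open>v\<close>, which makes all later magnitude estimates
  uniform.\<close>

lemma far_point:
  assumes "h \<in> \<Gamma>"
  obtains \<epsilon> where "\<epsilon> > 0"
    "\<And>u v. u \<in> B \<Longrightarrow> v \<in> B \<Longrightarrow> \<exists>z. d (Inr z) u > \<epsilon> \<and> d (Inr (h z)) v > \<epsilon>"
proof -
  obtain a b c :: 'a where ne: "a \<noteq> b" "a \<noteq> c" "b \<noteq> c" using three_points by metis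
  then have hne: "h a \<noteq> h b" "h a \<noteq> h c" "h b \<noteq> h c"
    using bij_element[OF assms] by (auto simp: bij_def inj_eq)
  let ?D = "{d (Inr a) (Inr b), d (Inr a) (Inr c), d (Inr b) (Inr c),
    d (Inr (h a)) (Inr (h b)), d (Inr (h a)) (Inr (h c)), d (Inr (h b)) (Inr (h c))}"
  define \<epsilon> where "\<epsilon> = Min ?D / 3"
  \<comment> \<open>A third of the least distance suffices: two points within \<epsilon> of a common
    point are at most 2\<epsilon> apart.\<close>
  have "d (Inr x) (Inr y) > 0" if "x \<noteq> y" for x y
    using d_pos that by simp
  then have "\<forall>t\<in>?D. t > 0" using ne hne by simp
  then have "\<epsilon> > 0" unfolding \<epsilon>_def by simp
  have le: "3 * \<epsilon> \<le> t" if "t \<in> ?D" for t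
    using Min_le[OF _ that] by (simp add: \<epsilon>_def)
  have "\<exists>z. d (Inr z) u > \<epsilon> \<and> d (Inr (h z)) v > \<epsilon>" if uv: "u \<in> B" "v \<in> B" for u v
  proof -
    have sep: "\<not> (d (Inr x) w \<le> \<epsilon> \<and> d (Inr y) w \<le> \<epsilon>)"
      if "d (Inr x) (Inr y) \<in> ?D" "w \<in> B" for x y w
      using triangle[of "Inr x" w "Inr y"] le[OF that(1)] \<open>\<epsilon> > 0\<close> that(2) commute[of w] by fastforce
    have "\<not> (d (Inr a) u \<le> \<epsilon> \<and> d (Inr b) u \<le> \<epsilon>)" "\<not> (d (Inr a) u \<le> \<epsilon> \<and> d (Inr c) u \<le> \<epsilon>)"
      "\<not> (d (Inr b) u \<le> \<epsilon> \<and> d (Inr c) u \<le> \<epsilon>)"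
      "\<not> (d (Inr (h a)) v \<le> \<epsilon> \<and> d (Inr (h b)) v \<le> \<epsilon>)" "\<not> (d (Inr (h a)) v \<le> \<epsilon> \<and> d (Inr (h c)) v \<le> \<epsilon>)"
      "\<not> (d (Inr (h b)) v \<le> \<epsilon> \<and> d (Inr (h c)) v \<le> \<epsilon>)"
      by (rule sep; use uv in simp)+
    then have "(\<not> d (Inr a) u \<le> \<epsilon> \<and> \<not> d (Inr (h a)) v \<le> \<epsilon>) \<or>
        (\<not> d (Inr b) u \<le> \<epsilon> \<and> \<not> d (Inr (h b)) v \<le> \<epsilon>) \<or>
        (\<not> d (Inr c) u \<le> \<epsilon> \<and> \<not> d (Inr (h c)) v \<le> \<epsilon>)"
      by argo
    then show ?thesis unfolding not_le by (elim disjE) blast+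
  qed
  then show ?thesis using that \<open>\<epsilon> > 0\<close> by blast
qed

lemma eventually_avoids:
  assumes "limitin X (\<lambda>n. Inl (g n)) (Inr x) sequentially" "finite F"
  shows "\<forall>\<^sub>F n in sequentially. g n \<notin> F"
proof -
  obtain r where r: "r > 0" "\<And>\<alpha> z. \<alpha> \<in> F \<inter> \<Gamma> \<Longrightarrow> z \<in> B \<Longrightarrow> z \<noteq> Inl \<alpha> \<Longrightarrow> d z (Inl \<alpha>) > r"
    using far_from_finite[of "F \<inter> \<Gamma>"] assms(2) by blast
  have "\<forall>\<^sub>F n in sequentially. Inl (g n) \<in> B \<and> d (Inl (g n)) (Inr x) < r"
    using assms(1) r(1) unfolding tends_metric by blast
  then show ?thesis
  proof eventually_elim
    case (elim n)
    then show ?case using r(2)[of "g n" "Inr x"] commute[of "Inr x"] by fastforce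
  qed
qed

lemma eventually_not_exceptional:
  assumes "limitin X (\<lambda>n. Inl (g n)) (Inr x) sequentially" "\<epsilon> > 0"
  shows "\<forall>\<^sub>F n in sequentially. g n \<notin> exceptional \<epsilon>"
  using eventually_avoids[OF assms(1) finite_exceptional[OF assms(2)]] .

lemma conv_loc_unif_off_pointwise:
  assumes "conv_loc_unif_off euclidean f y x" "z \<noteq> y" "open V" "x \<in> V"
  shows "\<forall>\<^sub>F n in sequentially. f n z \<in> V"
proof -
  obtain U where "z \<in> U" "\<forall>V. open V \<and> x \<in> V \<longrightarrow> (\<forall>\<^sub>F n in sequentially. f n ` (U - {y}) \<subseteq> V)"
    using assms(1,2) unfolding conv_loc_unif_off_def by auto
  then have "\<forall>\<^sub>F n in sequentially. f n ` (U - {y}) \<subseteq> V" using assms(3,4) by blast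
  then show ?thesis using \<open>z \<in> U\<close> assms(2) by (auto elim!: eventually_mono)
qed

lemma conv_loc_unif_off_pointwise_d:
  assumes "conv_loc_unif_off euclidean f y x" "z \<noteq> y" "\<epsilon> > 0"
  shows "\<forall>\<^sub>F n in sequentially. d (Inr (f n z)) (Inr x) < \<epsilon>"
  using conv_loc_unif_off_pointwise[OF assms(1,2) ball_M[of x \<epsilon>]] assms(3) by simp

text \<open>An injective \<open>h\<close> keeps the images of two points apart, whereas
  \<open>g n\<close> eventually brings both close to \<open>x\<close>.\<close>

lemma eventually_ne_of_conv:
  assumes conv: "conv_loc_unif_off euclidean g y x" and "h \<in> \<Gamma>"
  shows "\<forall>\<^sub>F n in sequentially. g n \<noteq> h"
proof -
  obtain a b where ab: "a \<noteq> y" "b \<noteq> y" "a \<noteq> b" using three_points by metis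
  then have "h a \<noteq> h b" using bij_element[OF assms(2)] by (auto simp: bij_def inj_eq)
  then have "d (Inr (h a)) (Inr (h b)) > 0" by (intro d_pos) auto
  then have e: "d (Inr (h a)) (Inr (h b)) / 2 > 0" by simp
  show ?thesis
    using conv_loc_unif_off_pointwise_d[OF conv ab(1) e] conv_loc_unif_off_pointwise_d[OF conv ab(2) e]
  proof eventually_elim
    case (elim n)
    then show ?case
      using triangle[of "Inr (h a)" "Inr x" "Inr (h b)"] commute[of "Inr x"] by auto
  qed
qed

text \<open>Of two points other than \<open>y\<close>, one is far from the inverse of
  \<open>g n\<close>; its image is then close to \<open>g n\<close> by the convergence estimate and
  close to \<open>x\<close> by assumption.\<close>

lemma tends_of_conv:
  assumes conv: "conv_loc_unif_off euclidean g y x" and g: "range g \<subseteq> \<Gamma>"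
  shows "limitin X (\<lambda>n. Inl (g n)) (Inr x) sequentially"
  unfolding tends_metric
proof (intro conjI allI impI)
  fix e :: real assume "e > 0"
  have gin: "g n \<in> \<Gamma>" for n using g by auto
  obtain a b where ab: "a \<noteq> y" "b \<noteq> y" "a \<noteq> b" using three_points by metis
  define \<epsilon> where "\<epsilon> = min (e/2) (d (Inr a) (Inr b) / 2)"
  have \<epsilon>: "\<epsilon> > 0" using \<open>e > 0\<close> d_pos[of "Inr a" "Inr b"] ab by (simp add: \<epsilon>_def)
  \<comment> \<open>The \<open>g n\<close> are not assumed distinct, so finiteness of the
    exceptional set has to be combined with the fact that each single element is eventually
    avoided.\<close>
  have "\<forall>\<^sub>F n in sequentially. \<forall>h\<in>exceptional \<epsilon>. g n \<noteq> h"
    using eventually_ne_of_conv[OF conv] exceptional_subset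
    by (intro eventually_ball_finite finite_exceptional \<epsilon>) blast
  then show "\<forall>\<^sub>F n in sequentially. Inl (g n) \<in> B \<and> d (Inl (g n)) (Inr x) < e"
    using conv_loc_unif_off_pointwise_d[OF conv ab(1) \<epsilon>] conv_loc_unif_off_pointwise_d[OF conv ab(2) \<epsilon>]
  proof eventually_elim
    case (elim n)
    have "d (Inr a) (Inl (inv (g n))) \<ge> \<epsilon> \<or> d (Inr b) (Inl (inv (g n))) \<ge> \<epsilon>"
      using triangle[of "Inr a" "Inl (inv (g n))" "Inr b"] gin[of n] commute[of "Inl (inv (g n))"]
      by (auto simp: \<epsilon>_def)
    then obtain z where z: "z = a \<or> z = b" "d (Inr z) (Inl (inv (g n))) \<ge> \<epsilon>" by blast
    then have "d (Inr (g n z)) (Inl (g n)) < \<epsilon>"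
      using not_exceptional[of "g n" \<epsilon> "Inr z"] elim(1) gin by auto
    moreover have "d (Inr (g n z)) (Inr x) < \<epsilon>" using z elim by auto
    moreover have "\<epsilon> \<le> e/2" by (simp add: \<epsilon>_def)
    ultimately show ?case
      using triangle[of "Inl (g n)" "Inr (g n z)" "Inr x"] gin[of n] commute[of "Inl (g n)"] by auto
  qed
qed simp

lemma conv_of_tends:
  assumes g: "\<And>n. g n \<in> \<Gamma>"
    and x: "limitin X (\<lambda>n. Inl (g n)) (Inr x) sequentially"
    and y: "limitin X (\<lambda>n. Inl (inv (g n))) (Inr y) sequentially"
  shows "conv_loc_unif_off euclidean g y x"
  unfolding conv_loc_unif_off_def
proof
  fix p assume "p \<in> topspace euclidean - {y}"
  \<comment> \<open>One third is spent on the neighbourhood of \<open>p\<close> and one on the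
    distance from the inverses to \<open>y\<close>; the last keeps the two apart.\<close>
  define r where "r = d (Inr p) (Inr y) / 3"
  have r: "r > 0" using d_pos[of "Inr p" "Inr y"] \<open>p \<in> _\<close> by (simp add: r_def)
  let ?U = "{z. d (Inr z) (Inr p) < r}"
  have "\<forall>\<^sub>F n in sequentially. g n ` (?U - {y}) \<subseteq> V" if V: "open V" "x \<in> V" for V
  proof -
    obtain e where e: "e > 0" "\<And>z. d (Inr z) (Inr x) < e \<Longrightarrow> z \<in> V"
      using open_M[OF V] by blast
    define \<epsilon> where "\<epsilon> = min r (e/2)"
    have \<epsilon>: "\<epsilon> > 0" using r e(1) by (simp add: \<epsilon>_def)
    show ?thesis
      using eventually_not_exceptional[OF x \<epsilon>] tends_D[OF y r] tends_D[OF x half_gt_zero[OF e(1)]]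
    proof eventually_elim
      case (elim n)
      show ?case
      proof (rule image_subsetI)
        fix z assume "z \<in> ?U - {y}"
        then have z: "d (Inr z) (Inr p) < r" by simp
        have "d (Inr z) (Inl (inv (g n))) \<ge> r"
          using triangle[of "Inr p" "Inr z" "Inr y"] triangle[of "Inr z" "Inl (inv (g n))" "Inr y"]
            elim(2) z commute[of "Inr p" "Inr z"] g[of n] by (auto simp: r_def)
        then have "d (Inr (g n z)) (Inl (g n)) < \<epsilon>"
          using not_exceptional[of "g n" \<epsilon> "Inr z"] elim(1) g by (auto simp: \<epsilon>_def)
        then have "d (Inr (g n z)) (Inr x) < e"
          using triangle[of "Inr (g n z)" "Inl (g n)" "Inr x"] elim(3) g[of n] by (auto simp: \<epsilon>_def)
        then show "g n z \<in> V" by (rule e(2))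
      qed
    qed
  qed
  then show "\<exists>U. openin euclidean U \<and> p \<in> U \<and>
      (\<forall>V. openin euclidean V \<and> x \<in> V \<longrightarrow> (\<forall>\<^sub>F n in sequentially. g n ` (U - {y}) \<subseteq> V))"
    using ball_M[of p r] r by (intro exI[of _ ?U]) auto
qed

lemma tends_unique: "limitin X s l sequentially \<Longrightarrow> limitin X s l' sequentially \<Longrightarrow> l = l'"
  using limitin_Hausdorff_unique[OF _ _ _ Hausdorff_space_mtopology] by (metis sequentially_bot)

section \<open>Powers and fixed points of elements separated from their inverses\<close>

text \<open>A point within \<epsilon> of \<open>h\<close> is more than \<epsilon> away from
  \<open>inv h\<close>, so \<open>h\<close> sends it back within \<epsilon> of \<open>h\<close>. The
  exponent starts at 1 because \<open>id\<close> need not be near \<open>h\<close>.\<close>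

lemma powers_near:
  assumes h: "h \<in> \<Gamma>" "h \<notin> exceptional \<epsilon>" "\<epsilon> > 0" "d (Inl h) (Inl (inv h)) > 2 * \<epsilon>"
  shows "d (Inl (h ^^ Suc n)) (Inl h) < \<epsilon>"
proof (induction n)
  case (Suc n)
  have "d (Inl (h ^^ Suc n)) (Inl (inv h)) \<ge> \<epsilon>"
    using triangle[of "Inl h" "Inl (h ^^ Suc n)" "Inl (inv h)"] commute[of "Inl h" "Inl (h ^^ Suc n)"] h Suc
      pow_in[of h "Suc n"] by (simp del: funpow.simps)
  then have "d (bord_act h (Inl (h ^^ Suc n))) (Inl h) < \<epsilon>"
    using h pow_in[of h "Suc n"] by (intro not_exceptional) (simp_all del: funpow.simps)
  then show ?case by (simp add: comp_def)
qed (use h in simp)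

lemma inj_powers:
  assumes h: "h \<in> \<Gamma>" and ne: "\<And>k. k > 0 \<Longrightarrow> h ^^ k \<noteq> id"
  shows "inj (\<lambda>n. h ^^ n)"
proof (rule linorder_injI)
  fix i j :: nat assume "i < j"
  show "h ^^ i \<noteq> h ^^ j"
  proof
    assume eq: "h ^^ i = h ^^ j"
    have "h ^^ j = h ^^ i \<circ> h ^^ (j - i)" using \<open>i < j\<close> by (metis funpow_add le_add_diff_inverse less_imp_le)
    then have "inv (h ^^ i) \<circ> (h ^^ i \<circ> h ^^ (j - i)) = inv (h ^^ i) \<circ> h ^^ i" using eq by simp
    then have "h ^^ (j - i) = id" using h by simp
    then show False using ne[of "j - i"] \<open>i < j\<close> by simp
  qed
qed

lemma pow_fixed: "h p = p \<Longrightarrow> (h ^^ n) p = p"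
  by (induction n) auto

lemma attracting_fixed_point:
  assumes h: "h \<in> \<Gamma>" "h \<notin> exceptional \<epsilon>" "\<epsilon> > 0" "d (Inl h) (Inl (inv h)) > 2 * \<epsilon>"
    and inj: "inj (\<lambda>n. h ^^ n)"
  obtains p where "h p = p" "d (Inr p) (Inl h) \<le> \<epsilon>"
proof -
  obtain p y r where r: "strict_mono r" "limitin X (\<lambda>n. Inl (h ^^ r n)) (Inr p) sequentially"
    and dyn: "\<forall>s z. limitin X s z sequentially \<longrightarrow> z \<noteq> Inr y \<longrightarrow>
      limitin X (\<lambda>n. bord_act (h ^^ r n) (s n)) (Inr p) sequentially"
    by (rule convergence_dynamics[OF inj]) (use h in auto)
  \<comment> \<open>A point of \<open>\<Gamma>\<close> is never the repelling point \<open>y\<close>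
    of M, so the powers carry the point \<open>h\<close> to \<open>p\<close>. As \<open>h\<close>
    commutes with its powers, the same sequence also tends to \<open>h p\<close>.\<close>
  have "limitin X (\<lambda>n. Inl h) (Inl h) sequentially" using h(1) by (simp add: limitin_const)
  then have "limitin X (\<lambda>n. bord_act (h ^^ r n) (Inl h)) (Inr p) sequentially"
    using dyn by blast
  moreover have "bord_act (h ^^ r n) (Inl h) = bord_act h (Inl (h ^^ r n))" for n
    by (simp add: funpow_swap1 fun_eq_iff)
  ultimately have "limitin X (\<lambda>n. bord_act h (Inl (h ^^ r n))) (Inr p) sequentially" by simp
  from tends_unique[OF this tends_act[OF h(1) r(2)]] have "h p = p" by simp
  moreover have "d (Inr p) (Inl h) \<le> \<epsilon>"
  proof (rule field_le_epsilon)
    fix e :: real assume "e > 0"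
    have "\<forall>\<^sub>F n in sequentially. d (Inr p) (Inl h) \<le> \<epsilon> + e"
      using tends_D[OF r(2) \<open>e > 0\<close>] eventually_gt_at_top[of 0]
    proof eventually_elim
      case (elim n)
      then have "r n > 0" using r(1) by (metis gr0I le_zero_eq less_numeral_extra(3) seq_suble)
      then have "d (Inl (h ^^ r n)) (Inl h) < \<epsilon>" using powers_near[OF h, of "r n - 1"] by simp
      then show ?case
        using triangle[of "Inr p" "Inl (h ^^ r n)" "Inl h"] elim(1) commute[of "Inr p"] h(1) by auto
    qed
    then show "d (Inr p) (Inl h) \<le> \<epsilon> + e" by simp
  qed
  ultimately show ?thesis using that by blast
qed

text \<open>Upgrades the subsequence to the full sequence: \<open>p\<close> is fixed by every power
  and stays away from the inverse powers, which remain near \<open>inv h\<close>; a non-exceptional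
  power is therefore close to \<open>p\<close>.\<close>

lemma powers_tend:
  assumes h: "h \<in> \<Gamma>" "inv h \<notin> exceptional \<epsilon>" "\<epsilon> > 0" "d (Inl h) (Inl (inv h)) > 2 * \<epsilon>"
    and inj: "inj (\<lambda>n. h ^^ n)"
    and p: "h p = p" "d (Inr p) (Inl h) \<le> \<epsilon>"
  shows "limitin X (\<lambda>n. Inl (h ^^ n)) (Inr p) sequentially"
  unfolding tends_metric
proof (intro conjI allI impI)
  fix e :: real assume "e > 0"
  \<comment> \<open>The second term is what remains of the separation after moving \<epsilon> from
    \<open>h\<close> to \<open>p\<close> and \<epsilon> from \<open>inv h\<close> to an inverse
    power.\<close>
  define \<eta> where "\<eta> = min e (d (Inl h) (Inl (inv h)) - 2 * \<epsilon>)"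
  have "\<eta> > 0" using h \<open>e > 0\<close> by (simp add: \<eta>_def)
  then have "finite ((\<lambda>n. h ^^ n) -` exceptional \<eta>)"
    by (intro finite_vimageI finite_exceptional inj)
  then have "\<forall>\<^sub>F n in sequentially. h ^^ n \<notin> exceptional \<eta>"
    by (simp add: cofinite_eq_sequentially[symmetric] eventually_cofinite vimage_def)
  then show "\<forall>\<^sub>F n in sequentially. Inl (h ^^ n) \<in> B \<and> d (Inl (h ^^ n)) (Inr p) < e"
    using eventually_gt_at_top[of 0]
  proof eventually_elim
    case (elim n)
    have "d (Inl (inv h ^^ n)) (Inl (inv h)) < \<epsilon>"
      using powers_near[of "inv h" \<epsilon> "n - 1"] h elim(2) commute[of "Inl h"] by simp
    then have "d (Inr p) (Inl (inv (h ^^ n))) \<ge> \<eta>"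
      using triangle[of "Inl h" "Inr p" "Inl (inv h)"] triangle[of "Inr p" "Inl (inv h ^^ n)" "Inl (inv h)"]
        p(2) h(1) commute[of "Inl h" "Inr p"] by (auto simp: \<eta>_def inv_pow)
    then have "d (Inr p) (Inl (h ^^ n)) < \<eta>"
      using not_exceptional[of "h ^^ n" \<eta> "Inr p"] elim(1) h(1) p(1) by (simp add: pow_fixed)
    then show ?case using h(1) commute[of "Inr p"] by (simp add: \<eta>_def)
  qed
qed simp

lemma loxodromic_of_separated:
  assumes h: "h \<in> \<Gamma>" "h \<notin> exceptional \<epsilon>" "inv h \<notin> exceptional \<epsilon>" "\<epsilon> > 0"
    "d (Inl h) (Inl (inv h)) > 2 * \<epsilon>"
  obtains p q where "loxodromic_with \<Gamma> h p q" "d (Inr p) (Inl h) \<le> \<epsilon>" "d (Inr q) (Inl (inv h)) \<le> \<epsilon>"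
proof -
  have h': "d (Inl (inv h)) (Inl (inv (inv h))) > 2 * \<epsilon>" using h commute by simp
  \<comment> \<open>Torsion would make \<open>id\<close> a positive power of both \<open>h\<close>
    and \<open>inv h\<close>, hence close to both.\<close>
  have "h ^^ k \<noteq> id" if "k > 0" for k
  proof
    assume "h ^^ k = id"
    then have "inv h ^^ k = id" using inv_pow[OF h(1), of k] by simp
    then have "d (Inl id) (Inl h) < \<epsilon>" "d (Inl id) (Inl (inv h)) < \<epsilon>"
      using powers_near[of h \<epsilon> "k - 1"] powers_near[of "inv h" \<epsilon> "k - 1"] h h' \<open>h ^^ k = id\<close> that by auto
    then show False using triangle[of "Inl h" "Inl id" "Inl (inv h)"] commute[of "Inl h"] h by auto
  qed
  then have inj: "inj (\<lambda>n. h ^^ n)" using inj_powers h(1) by blast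
  have inj': "inj (\<lambda>n. inv h ^^ n)"
  proof (rule injI)
    fix m n assume "inv h ^^ m = inv h ^^ n"
    then have "inv (inv h ^^ m) = inv (inv h ^^ n)" by simp
    then have "h ^^ m = h ^^ n" using h(1) by (simp add: inv_pow)
    then show "m = n" using inj by (auto dest: injD)
  qed
  obtain p where p: "h p = p" "d (Inr p) (Inl h) \<le> \<epsilon>"
    using attracting_fixed_point[OF h(1,2,4,5) inj] by blast
  obtain q where q: "inv h q = q" "d (Inr q) (Inl (inv h)) \<le> \<epsilon>"
    using attracting_fixed_point[OF _ h(3,4) h' inj'] h(1) by auto
  have tp: "limitin X (\<lambda>n. Inl (h ^^ n)) (Inr p) sequentially"
    using powers_tend[OF h(1,3,4,5) inj p] .
  have tq: "limitin X (\<lambda>n. Inl (inv h ^^ n)) (Inr q) sequentially"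
    using powers_tend[OF _ _ h(4) h' inj' q] h by simp
  have c1: "conv_loc_unif_off euclidean (\<lambda>n. h ^^ n) q p"
    using conv_of_tends[OF _ tp, of q] tq h(1) by (simp add: inv_pow)
  have c2: "conv_loc_unif_off euclidean (\<lambda>n. inv h ^^ n) p q"
    using conv_of_tends[OF _ tq, of p] tp h(1) inv_pow[of "inv h"] by simp
  have "p \<noteq> q"
    using triangle[of "Inl h" "Inr p" "Inl (inv h)"] p(2) q(2) h(1,5) commute[of "Inl h" "Inr p"] by auto
  moreover have "p \<in> limit_set \<Gamma>"
    unfolding limit_set_def using c1 h(1) by (intro CollectI exI[of _ q] exI[of _ "\<lambda>n. h ^^ n"]) auto
  moreover have "q \<in> limit_set \<Gamma>"
    unfolding limit_set_def using c2 h(1) by (intro CollectI exI[of _ p] exI[of _ "\<lambda>n. inv h ^^ n"]) auto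
  moreover have "h q = q" using q(1) h(1) inv_right by metis
  ultimately have "loxodromic_with \<Gamma> h p q"
    unfolding loxodromic_with_def using h(1) p(1) c1 c2 by blast
  then show ?thesis using that p(2) q(2) by blast
qed

lemma loxodromic_inv: "loxodromic_with \<Gamma> h p q \<Longrightarrow> loxodromic_with \<Gamma> (inv h) q p"
  unfolding loxodromic_with_def using inv_left[of h p] inv_left[of h q] by auto

lemma loxodromic_tends:
  assumes "loxodromic_with \<Gamma> h p q"
  shows "limitin X (\<lambda>n. Inl (h ^^ n)) (Inr p) sequentially"
    "limitin X (\<lambda>n. Inl (inv h ^^ n)) (Inr q) sequentially"
  using assms unfolding loxodromic_with_def by (auto intro!: tends_of_conv)

lemma loxodromic_fixed:
  assumes "loxodromic_with \<Gamma> h p q" "h r = r"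
  shows "r = p \<or> r = q"
proof (rule ccontr)
  assume *: "\<not> ?thesis"
  then have "\<forall>\<^sub>F n in sequentially. d (Inr ((h ^^ n) r)) (Inr p) < d (Inr r) (Inr p)"
    using assms(1) d_pos[of "Inr r" "Inr p"] unfolding loxodromic_with_def
    by (intro conv_loc_unif_off_pointwise_d) auto
  then show False using assms(2) by (simp add: pow_fixed)
qed

text \<open>The element \<open>g n \<circ> f\<close> is the image of the point \<open>f\<close> of
  the compactification under \<open>g n\<close>. This point is isolated, hence far from the inverse
  of \<open>g n\<close> unless equal to it, so the convergence estimate brings the image close to
  \<open>g n\<close>.\<close>

lemma tends_comp_right:
  assumes g: "\<And>n. g n \<in> \<Gamma>" and lim: "limitin X (\<lambda>n. Inl (g n)) (Inr x) sequentially" and f: "f \<in> \<Gamma>"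
  shows "limitin X (\<lambda>n. Inl (g n \<circ> f)) (Inr x) sequentially"
  unfolding tends_metric
proof (intro conjI allI impI)
  fix \<epsilon> :: real assume "\<epsilon> > 0"
  obtain r where r: "r > 0" "\<And>\<alpha> z. \<alpha> \<in> {f} \<Longrightarrow> z \<in> B \<Longrightarrow> z \<noteq> Inl \<alpha> \<Longrightarrow> d z (Inl \<alpha>) > r"
    using far_from_finite[of "{f}"] f by auto
  define e where "e = min (\<epsilon>/2) r"
  have e: "e > 0" "e \<le> \<epsilon>/2" "e \<le> r" using \<open>\<epsilon> > 0\<close> r(1) by (auto simp: e_def)
  have "\<forall>\<^sub>F n in sequentially. g n \<notin> {inv f}"
    by (rule eventually_avoids[OF lim]) simp
  then show "\<forall>\<^sub>F n in sequentially. Inl (g n \<circ> f) \<in> B \<and> d (Inl (g n \<circ> f)) (Inr x) < \<epsilon>"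
    using eventually_not_exceptional[OF lim e(1)] tends_D[OF lim half_gt_zero[OF \<open>\<epsilon> > 0\<close>]]
  proof eventually_elim
    case (elim n)
    have "inv (g n) \<noteq> f" using elim(1) g[of n] by auto
    then have "d (Inl (inv (g n))) (Inl f) > r" using r(2)[of f "Inl (inv (g n))"] g[of n] by simp
    then have "d (Inl (g n \<circ> f)) (Inl (g n)) < e"
      using not_exceptional[OF g elim(2), of "Inl f"] f e(3) commute[of "Inl f" "Inl (inv (g n))"] by simp
    then show ?case
      using triangle[of "Inl (g n \<circ> f)" "Inl (g n)" "Inr x"] g[of n] f elim(3) e(2) by simp
  qed
qed simp

lemma act_near:
  assumes "\<gamma> \<in> \<Gamma>" "z \<in> B" "r > 0"
  obtains s where "s > 0" "\<And>w. w \<in> B \<Longrightarrow> d z w < s \<Longrightarrow> d (bord_act \<gamma> z) (bord_act \<gamma> w) < r"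
proof -
  let ?W = "{w \<in> topspace X. bord_act \<gamma> w \<in> mball (bord_act \<gamma> z) r}"
  have "openin X ?W"
    using openin_continuous_map_preimage[OF act_continuous[OF assms(1)] openin_mball] by blast
  moreover have "z \<in> ?W" using assms act_in_B by simp
  ultimately obtain s where s: "s > 0" "mball z s \<subseteq> ?W"
    unfolding openin_mtopology by blast
  have "d (bord_act \<gamma> z) (bord_act \<gamma> w) < r" if "w \<in> B" "d z w < s" for w
  proof -
    have "w \<in> mball z s" using that assms(2) by simp
    then have "w \<in> ?W" using s(2) by (rule rev_subsetD)
    then show ?thesis by simp
  qed
  then show ?thesis using that s(1) by blast
qed

section \<open>The filters of group elements tending to a point of M\<close>

lemma eventually_tending_to:
  "eventually P (tending_to \<Gamma> d x) \<longleftrightarrow> (\<exists>r>0. \<forall>\<alpha>\<in>\<Gamma>. d (Inr x) (Inl \<alpha>) < r \<longrightarrow> P \<alpha>)"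
proof
  assume "eventually P (tending_to \<Gamma> d x)"
  then obtain Q where Q: "eventually Q (atin_within X (Inr x) (Inl ` \<Gamma>))" "\<And>\<alpha>. Q (Inl \<alpha>) \<Longrightarrow> P \<alpha>"
    unfolding tending_to_def eventually_filtercomap by blast
  then obtain T where T: "openin X T" "Inr x \<in> T" "\<forall>z\<in>T. z \<in> Inl ` \<Gamma> \<and> z \<noteq> Inr x \<longrightarrow> Q z"
    unfolding eventually_atin_within by auto
  obtain r where r: "r > 0" "mball (Inr x) r \<subseteq> T"
    using T openin_mtopology by metis
  have "P \<alpha>" if "\<alpha> \<in> \<Gamma>" "d (Inr x) (Inl \<alpha>) < r" for \<alpha>
  proof -
    have "Inl \<alpha> \<in> T" using r(2) that by (auto simp: subset_iff)
    then show ?thesis using T(3) Q(2) that by auto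
  qed
  then show "\<exists>r>0. \<forall>\<alpha>\<in>\<Gamma>. d (Inr x) (Inl \<alpha>) < r \<longrightarrow> P \<alpha>" using r(1) by blast
next
  assume "\<exists>r>0. \<forall>\<alpha>\<in>\<Gamma>. d (Inr x) (Inl \<alpha>) < r \<longrightarrow> P \<alpha>"
  then obtain r where r: "r > 0" "\<forall>\<alpha>\<in>\<Gamma>. d (Inr x) (Inl \<alpha>) < r \<longrightarrow> P \<alpha>" by blast
  define Q where "Q z \<longleftrightarrow> (\<exists>\<alpha>\<in>\<Gamma>. z = Inl \<alpha> \<and> d (Inr x) (Inl \<alpha>) < r)" for z :: "('a \<Rightarrow> 'a) + 'a"
  have "eventually Q (atin_within X (Inr x) (Inl ` \<Gamma>))"
    unfolding eventually_atin_within
    by (intro disjI2 exI[of _ "mball (Inr x) r"]) (use r(1) in \<open>auto simp: Q_def\<close>)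
  moreover have "P \<alpha>" if "Q (Inl \<alpha>)" for \<alpha> using that r(2) by (auto simp: Q_def)
  ultimately show "eventually P (tending_to \<Gamma> d x)"
    unfolding tending_to_def eventually_filtercomap by blast
qed

lemma tending_to_nontrivial:
  assumes "x \<in> limit_set \<Gamma>"
  shows "tending_to \<Gamma> d x \<noteq> bot"
proof
  assume "tending_to \<Gamma> d x = bot"
  then have "eventually (\<lambda>_. False) (tending_to \<Gamma> d x)" by simp
  then obtain r where r: "r > 0" "\<forall>\<alpha>\<in>\<Gamma>. \<not> d (Inr x) (Inl \<alpha>) < r"
    unfolding eventually_tending_to by blast
  obtain y g where g: "range g \<subseteq> \<Gamma>" "conv_loc_unif_off euclidean g y x"
    using assms unfolding limit_set_def by blast
  have "\<forall>\<^sub>F n in sequentially. d (Inl (g n)) (Inr x) < r"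
    using tends_D[OF tends_of_conv[OF g(2,1)] r(1)] .
  then obtain n where "d (Inl (g n)) (Inr x) < r"
    using eventually_happens'[OF sequentially_bot] by blast
  then show False using r(2) g(1) commute[of "Inl (g n)" "Inr x"] by auto
qed

lemma tending_to_act:
  assumes "\<gamma> \<in> \<Gamma>"
  shows "filterlim (\<lambda>\<alpha>. \<gamma> \<circ> \<alpha>) (tending_to \<Gamma> d (\<gamma> x)) (tending_to \<Gamma> d x)"
  unfolding filterlim_iff
proof (intro allI impI)
  fix P assume "eventually P (tending_to \<Gamma> d (\<gamma> x))"
  then obtain r where r: "r > 0" "\<forall>\<alpha>\<in>\<Gamma>. d (Inr (\<gamma> x)) (Inl \<alpha>) < r \<longrightarrow> P \<alpha>"
    unfolding eventually_tending_to by blast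
  obtain s where s: "s > 0" "\<And>w. w \<in> B \<Longrightarrow> d (Inr x) w < s \<Longrightarrow> d (bord_act \<gamma> (Inr x)) (bord_act \<gamma> w) < r"
    using act_near[OF assms, of "Inr x", OF _ r(1)] by auto
  have "P (\<gamma> \<circ> \<alpha>)" if "\<alpha> \<in> \<Gamma>" "d (Inr x) (Inl \<alpha>) < s" for \<alpha>
    using r(2) s(2)[of "Inl \<alpha>"] that assms by simp
  then show "\<forall>\<^sub>F \<alpha> in tending_to \<Gamma> d x. P (\<gamma> \<circ> \<alpha>)"
    unfolding eventually_tending_to using s(1) by blast
qed

text \<open>Makes the limsup at the translated pair finite: the filter at \<open>\<gamma> x\<close>
  is coarser than an image of the one at \<open>x\<close>.\<close>

lemma tending_to_act_nontrivial:
  assumes "\<gamma> \<in> \<Gamma>" "tending_to \<Gamma> d x \<noteq> bot"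
  shows "tending_to \<Gamma> d (\<gamma> x) \<noteq> bot"
  using tending_to_act[OF assms(1), of x] assms(2) unfolding filterlim_def
  by (metis bot.extremum_uniqueI filtermap_bot_iff)

end

section \<open>Magnitudes\<close>

locale expanding_cocycle = bordified_convergence_group \<Gamma> d
  for \<Gamma> :: "('a::metric_space \<Rightarrow> 'a) set" and d +
  fixes \<sigma> :: "('a \<Rightarrow> 'a) \<Rightarrow> 'a \<Rightarrow> real" and mag :: "('a \<Rightarrow> 'a) \<Rightarrow> real" and \<kappa> :: real
  assumes coarse: "kappa_coarse_cocycle \<kappa> \<Gamma> UNIV \<sigma>"
    and proper: "proper_cocycle \<Gamma> d \<sigma>"
    and magnitude: "magnitude \<Gamma> d \<sigma> mag"
begin

lemma kappa_nonneg: "\<kappa> \<ge> 0"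
  using coarse by (simp add: kappa_coarse_cocycle_def)

lemma cocycle: "\<alpha> \<in> \<Gamma> \<Longrightarrow> \<beta> \<in> \<Gamma> \<Longrightarrow> \<bar>\<sigma> (\<alpha> \<circ> \<beta>) x - (\<sigma> \<alpha> (\<beta> x) + \<sigma> \<beta> x)\<bar> \<le> \<kappa>"
  using coarse by (simp add: kappa_coarse_cocycle_def)

lemma cocycle_id: "\<bar>\<sigma> id x\<bar> \<le> \<kappa>"
  using cocycle[of id id x] by simp

lemma cocycle_inv: "\<alpha> \<in> \<Gamma> \<Longrightarrow> \<bar>\<sigma> (inv \<alpha>) (\<alpha> x) + \<sigma> \<alpha> x\<bar> \<le> 2 * \<kappa>"
  using cocycle[of "inv \<alpha>" \<alpha> x] cocycle_id[of x] by simp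

lemma coarse_continuity:
  assumes "\<gamma> \<in> \<Gamma>"
  obtains r where "r > 0" "\<And>y. d (Inr y) (Inr x) < r \<Longrightarrow> \<bar>\<sigma> \<gamma> x - \<sigma> \<gamma> y\<bar> \<le> \<kappa> + 1"
proof -
  have "Limsup (at x) (\<lambda>y. ereal \<bar>\<sigma> \<gamma> x - \<sigma> \<gamma> y\<bar>) \<le> ereal \<kappa>"
    using coarse assms by (simp add: kappa_coarse_cocycle_def)
  \<comment> \<open>A bound on the limsup controls nearby values only up to an arbitrary positive
    excess, taken to be 1.\<close>
  also have "\<dots> < ereal (\<kappa> + 1)" by simp
  finally have "\<forall>\<^sub>F y in at x. ereal \<bar>\<sigma> \<gamma> x - \<sigma> \<gamma> y\<bar> < ereal (\<kappa> + 1)"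
    by (rule Limsup_lessD)
  then obtain U where U: "open U" "x \<in> U" "\<And>y. y \<in> U \<Longrightarrow> y \<noteq> x \<Longrightarrow> \<bar>\<sigma> \<gamma> x - \<sigma> \<gamma> y\<bar> < \<kappa> + 1"
    unfolding eventually_at_topological by auto
  obtain r where r: "r > 0" "\<And>y. d (Inr y) (Inr x) < r \<Longrightarrow> y \<in> U"
    using open_M[OF U(1,2)] by blast
  have "\<bar>\<sigma> \<gamma> x - \<sigma> \<gamma> y\<bar> \<le> \<kappa> + 1" if "d (Inr y) (Inr x) < r" for y
    using U(3)[OF r(2)[OF that]] kappa_nonneg by (cases "y = x") auto
  then show ?thesis using that r(1) by blast
qed

lemma mag_bound:
  assumes "\<epsilon> > 0"
  obtains C where "\<And>x \<gamma>. \<gamma> \<in> \<Gamma> \<Longrightarrow> d (Inr x) (Inl (inv \<gamma>)) > \<epsilon> \<Longrightarrow> \<bar>\<sigma> \<gamma> x - mag \<gamma>\<bar> \<le> C"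
proof -
  obtain C where C: "C > 0" "\<forall>x. \<forall>\<gamma>\<in>\<Gamma>. d (Inr x) (Inl (inv \<gamma>)) > \<epsilon> \<longrightarrow>
        mag \<gamma> - C \<le> \<sigma> \<gamma> x \<and> \<sigma> \<gamma> x \<le> mag \<gamma> + C"
    using magnitude assms unfolding magnitude_def by meson
  have "\<bar>\<sigma> \<gamma> x - mag \<gamma>\<bar> \<le> C" if "\<gamma> \<in> \<Gamma>" "d (Inr x) (Inl (inv \<gamma>)) > \<epsilon>" for x \<gamma>
    using C(2)[rule_format, OF that] by auto
  then show ?thesis using that by blast
qed

section \<open>Magnitudes of products\<close>

text \<open>All of M lies at a definite distance from the isolated point \<open>inv h\<close>, so a
  single instance of the magnitude estimate covers every \<open>x\<close>.\<close>

lemma cocycle_bounded: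
  assumes "h \<in> \<Gamma>"
  obtains C where "\<And>x. \<bar>\<sigma> h x\<bar> \<le> C"
proof -
  obtain r where r: "r > 0" "\<And>\<alpha> z. \<alpha> \<in> {inv h} \<Longrightarrow> z \<in> B \<Longrightarrow> z \<noteq> Inl \<alpha> \<Longrightarrow> d z (Inl \<alpha>) > r"
    using far_from_finite[of "{inv h}"] assms by auto
  obtain C where C: "\<And>x \<gamma>. \<gamma> \<in> \<Gamma> \<Longrightarrow> d (Inr x) (Inl (inv \<gamma>)) > r \<Longrightarrow> \<bar>\<sigma> \<gamma> x - mag \<gamma>\<bar> \<le> C"
    using mag_bound[OF r(1)] by blast
  have "\<bar>\<sigma> h x\<bar> \<le> C + \<bar>mag h\<bar>" for x
    using C[of h x] r(2)[of "inv h" "Inr x"] assms by auto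
  then show ?thesis using that by blast
qed

text \<open>With \<open>z\<close> far from the inverse of \<open>g \<circ> h\<close> and
  \<open>h z\<close> far from the inverse of \<open>g\<close>, the cocycle identity at
  \<open>z\<close> compares the two magnitudes up to the bounded term \<sigma>(h, z).\<close>

lemma mag_comp_right:
  assumes "h \<in> \<Gamma>"
  obtains C where "\<And>g. g \<in> \<Gamma> \<Longrightarrow> \<bar>mag (g \<circ> h) - mag g\<bar> \<le> C"
proof -
  obtain \<epsilon> where e: "\<epsilon> > 0"
    "\<And>u v. u \<in> B \<Longrightarrow> v \<in> B \<Longrightarrow> \<exists>z. d (Inr z) u > \<epsilon> \<and> d (Inr (h z)) v > \<epsilon>"
    using far_point[OF assms] by blast
  obtain C where C: "\<And>x \<gamma>. \<gamma> \<in> \<Gamma> \<Longrightarrow> d (Inr x) (Inl (inv \<gamma>)) > \<epsilon> \<Longrightarrow> \<bar>\<sigma> \<gamma> x - mag \<gamma>\<bar> \<le> C"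
    using mag_bound[OF e(1)] by blast
  obtain K where K: "\<And>x. \<bar>\<sigma> h x\<bar> \<le> K" using cocycle_bounded[OF assms] by blast
  have "\<bar>mag (g \<circ> h) - mag g\<bar> \<le> 2 * C + K + \<kappa>" if g: "g \<in> \<Gamma>" for g
  proof -
    obtain z where z: "d (Inr z) (Inl (inv (g \<circ> h))) > \<epsilon>" "d (Inr (h z)) (Inl (inv g)) > \<epsilon>"
      using e(2)[of "Inl (inv (g \<circ> h))" "Inl (inv g)"] g assms by auto
    show ?thesis
      using C[OF comp_in[OF g assms] z(1)] C[OF g z(2)] K[of z] cocycle[OF g assms, of z] by linarith
  qed
  then show ?thesis using that by blast
qed

lemma mag_comp_left:
  assumes "h \<in> \<Gamma>"
  obtains C where "\<And>g. g \<in> \<Gamma> \<Longrightarrow> \<bar>mag (h \<circ> g) - mag g\<bar> \<le> C"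
proof -
  obtain \<epsilon> where e: "\<epsilon> > 0"
    "\<And>u v. u \<in> B \<Longrightarrow> v \<in> B \<Longrightarrow> \<exists>z. d (Inr z) u > \<epsilon> \<and> d (Inr (id z)) v > \<epsilon>"
    using far_point[OF id_in] by blast
  obtain C where C: "\<And>x \<gamma>. \<gamma> \<in> \<Gamma> \<Longrightarrow> d (Inr x) (Inl (inv \<gamma>)) > \<epsilon> \<Longrightarrow> \<bar>\<sigma> \<gamma> x - mag \<gamma>\<bar> \<le> C"
    using mag_bound[OF e(1)] by blast
  obtain K where K: "\<And>x. \<bar>\<sigma> h x\<bar> \<le> K" using cocycle_bounded[OF assms] by blast
  have "\<bar>mag (h \<circ> g) - mag g\<bar> \<le> 2 * C + K + \<kappa>" if g: "g \<in> \<Gamma>" for g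
  proof -
    obtain z where z: "d (Inr z) (Inl (inv (h \<circ> g))) > \<epsilon>" "d (Inr z) (Inl (inv g)) > \<epsilon>"
      using e(2)[of "Inl (inv (h \<circ> g))" "Inl (inv g)"] g assms by auto
    show ?thesis
      using C[OF comp_in[OF assms g] z(1)] C[OF g z(2)] K[of "g z"] cocycle[OF assms g, of z] by linarith
  qed
  then show ?thesis using that by blast
qed

text \<open>A test point \<open>z\<close> far from the inverses of \<open>a\<close> and
  \<open>b \<circ> a\<close> is moved by \<open>a\<close> close to \<open>a\<close>, hence away from
  \<open>inv b\<close>. All three terms of the cocycle identity at \<open>z\<close> are then
  magnitudes up to bounded error.\<close>

lemma mag_comp_separated:
  assumes "\<delta> > 0"
  obtains C where "\<And>a b. a \<in> \<Gamma> \<Longrightarrow> b \<in> \<Gamma> \<Longrightarrow> d (Inl a) (Inl (inv b)) \<ge> \<delta> \<Longrightarrow>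
    \<bar>mag a + mag b - mag (b \<circ> a)\<bar> \<le> C"
proof -
  obtain \<epsilon> where \<epsilon>: "\<epsilon> > 0"
    "\<And>u v. u \<in> B \<Longrightarrow> v \<in> B \<Longrightarrow> \<exists>z. d (Inr z) u > \<epsilon> \<and> d (Inr (id z)) v > \<epsilon>"
    using far_point[OF id_in] by blast
  define e where "e = min \<epsilon> (\<delta>/2)"
  have e: "e > 0" "e \<le> \<epsilon>" "e \<le> \<delta>/2" using \<epsilon>(1) assms by (auto simp: e_def)
  obtain C where C: "\<And>x \<gamma>. \<gamma> \<in> \<Gamma> \<Longrightarrow> d (Inr x) (Inl (inv \<gamma>)) > e \<Longrightarrow> \<bar>\<sigma> \<gamma> x - mag \<gamma>\<bar> \<le> C"
    using mag_bound[OF e(1)] by blast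
  have "\<exists>K. \<forall>b\<in>\<Gamma>. \<bar>mag (b \<circ> a) - mag b\<bar> \<le> K" if "a \<in> exceptional e" for a
  proof -
    have "a \<in> \<Gamma>" using that exceptional_subset by blast
    then obtain K where "\<And>b. b \<in> \<Gamma> \<Longrightarrow> \<bar>mag (b \<circ> a) - mag b\<bar> \<le> K"
      using mag_comp_right by blast
    then show ?thesis by blast
  qed
  then obtain K where K: "\<And>a b. a \<in> exceptional e \<Longrightarrow> b \<in> \<Gamma> \<Longrightarrow> \<bar>mag (b \<circ> a) - mag b\<bar> \<le> K a"
    by metis
  \<comment> \<open>For the finitely many exceptional \<open>a\<close> the product differs from
    \<open>b\<close> by a fixed right factor; summing their bounds gives a common one.\<close>
  define L where "L = (\<Sum>a\<in>exceptional e. \<bar>K a\<bar> + \<bar>mag a\<bar>)"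
  have "\<bar>mag a + mag b - mag (b \<circ> a)\<bar> \<le> max L (3 * C + \<kappa>)"
    if ab: "a \<in> \<Gamma>" "b \<in> \<Gamma>" "d (Inl a) (Inl (inv b)) \<ge> \<delta>" for a b
  proof (cases "a \<in> exceptional e")
    case True
    have "\<bar>K a\<bar> + \<bar>mag a\<bar> \<le> L"
      unfolding L_def by (rule member_le_sum[OF True]) (auto simp: finite_exceptional e)
    then show ?thesis using K[OF True ab(2)] by linarith
  next
    case False
    obtain z where z: "d (Inr z) (Inl (inv (b \<circ> a))) > \<epsilon>" "d (Inr z) (Inl (inv a)) > \<epsilon>"
      using \<epsilon>(2)[of "Inl (inv (b \<circ> a))" "Inl (inv a)"] ab by auto
    have "d (Inr (a z)) (Inl a) < e"
      using not_exceptional[OF ab(1) False, of "Inr z"] z e by simp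
    then have "d (Inr (a z)) (Inl (inv b)) > e"
      using triangle[of "Inl a" "Inr (a z)" "Inl (inv b)"] ab e commute[of "Inl a" "Inr (a z)"] by auto
    from C[OF ab(2) this] C[OF ab(1), of z] C[OF comp_in[OF ab(2,1)], of z] cocycle[OF ab(2,1), of z] z e
    show ?thesis by linarith
  qed
  then show ?thesis using that by blast
qed

text \<open>For \<alpha> near \<open>x\<close> and a suitable test point \<open>z\<close>, the point
  \<alpha>(z) is near \<alpha>, hence near \<open>x\<close>, and coarse continuity replaces
  \<sigma>(\<gamma>, \<alpha>(z)) by \<sigma>(\<gamma>, x). The radius depends on \<gamma> and
  \<open>x\<close>, but the constant does not, as the GPS identity requires.\<close>

lemma mag_comp_near_limit:
  obtains C where "\<And>\<gamma> x. \<gamma> \<in> \<Gamma> \<Longrightarrow> \<exists>r>0. \<forall>\<alpha>\<in>\<Gamma>. d (Inr x) (Inl \<alpha>) < r \<longrightarrow>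
    \<bar>mag (\<gamma> \<circ> \<alpha>) - mag \<alpha> - \<sigma> \<gamma> x\<bar> \<le> C"
proof -
  obtain \<epsilon> where \<epsilon>: "\<epsilon> > 0"
    "\<And>u v. u \<in> B \<Longrightarrow> v \<in> B \<Longrightarrow> \<exists>z. d (Inr z) u > \<epsilon> \<and> d (Inr (id z)) v > \<epsilon>"
    using far_point[OF id_in] by blast
  obtain C where C: "\<And>x \<gamma>. \<gamma> \<in> \<Gamma> \<Longrightarrow> d (Inr x) (Inl (inv \<gamma>)) > \<epsilon> \<Longrightarrow> \<bar>\<sigma> \<gamma> x - mag \<gamma>\<bar> \<le> C"
    using mag_bound[OF \<epsilon>(1)] by blast
  have "\<exists>r>0. \<forall>\<alpha>\<in>\<Gamma>. d (Inr x) (Inl \<alpha>) < r \<longrightarrow>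
    \<bar>mag (\<gamma> \<circ> \<alpha>) - mag \<alpha> - \<sigma> \<gamma> x\<bar> \<le> 2 * C + 2 * \<kappa> + 1" if \<gamma>: "\<gamma> \<in> \<Gamma>" for \<gamma> x
  proof -
    obtain r where r: "r > 0" "\<And>y. d (Inr y) (Inr x) < r \<Longrightarrow> \<bar>\<sigma> \<gamma> x - \<sigma> \<gamma> y\<bar> \<le> \<kappa> + 1"
      using coarse_continuity[OF \<gamma>] by blast
    define e where "e = min \<epsilon> (r/2)"
    have e: "e > 0" "e \<le> \<epsilon>" "e \<le> r/2" using \<epsilon>(1) r(1) by (auto simp: e_def)
    obtain s where s: "s > 0" "\<And>\<alpha> z. \<alpha> \<in> exceptional e \<Longrightarrow> z \<in> B \<Longrightarrow> z \<noteq> Inl \<alpha> \<Longrightarrow> d z (Inl \<alpha>) > s"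
      using far_from_finite[OF finite_exceptional[OF e(1)] exceptional_subset] by blast
    have "\<bar>mag (\<gamma> \<circ> \<alpha>) - mag \<alpha> - \<sigma> \<gamma> x\<bar> \<le> 2 * C + 2 * \<kappa> + 1"
      if \<alpha>: "\<alpha> \<in> \<Gamma>" "d (Inr x) (Inl \<alpha>) < min s (r/2)" for \<alpha>
    proof -
      have ne: "\<alpha> \<notin> exceptional e" using s(2)[of \<alpha> "Inr x"] \<alpha>(2) by auto
      obtain z where z: "d (Inr z) (Inl (inv (\<gamma> \<circ> \<alpha>))) > \<epsilon>" "d (Inr z) (Inl (inv \<alpha>)) > \<epsilon>"
        using \<epsilon>(2)[of "Inl (inv (\<gamma> \<circ> \<alpha>))" "Inl (inv \<alpha>)"] \<alpha> \<gamma> by auto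
      have "d (Inr (\<alpha> z)) (Inl \<alpha>) < e"
        using not_exceptional[OF \<alpha>(1) ne, of "Inr z"] z e by simp
      then have "d (Inr (\<alpha> z)) (Inr x) < r"
        using triangle[of "Inr (\<alpha> z)" "Inl \<alpha>" "Inr x"] \<alpha> e commute[of "Inl \<alpha>" "Inr x"] by auto
      from r(2)[OF this] C[OF \<alpha>(1) z(2)] C[OF comp_in[OF \<gamma> \<alpha>(1)] z(1)] cocycle[OF \<gamma> \<alpha>(1), of z]
      show ?thesis by linarith
    qed
    moreover have "min s (r/2) > 0" using s(1) r(1) by simp
    ultimately show ?thesis by blast
  qed
  then show ?thesis using that by blast
qed

section \<open>Absence of a global fixed point\<close>

text \<open>Properness in contrapositive form: an infinite set would contain a sequence of distinct
  elements along which \<sigma> stays bounded.\<close>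

lemma finite_loxodromic:
  assumes "\<epsilon> > 0"
  shows "finite {h. \<exists>p q. loxodromic_with \<Gamma> h p q \<and> d (Inr q) (Inr p) \<ge> \<epsilon> \<and> \<sigma> h p \<le> C}"
    (is "finite ?S")
proof (rule ccontr)
  assume "infinite ?S"
  then obtain g :: "nat \<Rightarrow> 'a \<Rightarrow> 'a" where g: "inj g" "range g \<subseteq> ?S"
    using infinite_countable_subset by blast
  then have "\<forall>n. \<exists>p q. loxodromic_with \<Gamma> (g n) p q \<and> d (Inr q) (Inr p) \<ge> \<epsilon> \<and> \<sigma> (g n) p \<le> C"
    by blast
  then obtain p q where pq: "\<And>n. loxodromic_with \<Gamma> (g n) (p n) (q n)"
    "\<And>n. d (Inr (q n)) (Inr (p n)) \<ge> \<epsilon>" "\<And>n. \<sigma> (g n) (p n) \<le> C"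
    by metis
  have "ereal \<epsilon> \<le> liminf (\<lambda>n. ereal (d (Inr (q n)) (Inr (p n))))"
    using pq(2) by (intro Liminf_bounded) auto
  then have "liminf (\<lambda>n. ereal (d (Inr (q n)) (Inr (p n)))) > 0"
    using assms by (metis ereal_less(2) order_less_le_trans)
  then have "filterlim (\<lambda>n. \<sigma> (g n) (p n)) at_top sequentially"
    using proper g(1) pq(1) unfolding proper_cocycle_def by blast
  then have "\<forall>\<^sub>F n in sequentially. C + 1 \<le> \<sigma> (g n) (p n)"
    by (simp add: filterlim_at_top)
  then have "\<forall>\<^sub>F n in sequentially. False"
    by eventually_elim (use pq(3) in \<open>smt (verit)\<close>)
  then show False by simp
qed

text \<open>The point \<open>h u\<close> is far from \<open>q\<close>, hence from \<open>h\<close>,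
  so \<open>u\<close> must be close to \<open>inv h\<close>. Since \<open>u\<close> is far from
  \<open>q\<close>, this separates \<open>h\<close> from \<open>inv h\<close>, and the fixed point
  \<open>q\<close>, being near \<open>h\<close>, is the attracting one.\<close>

lemma loxodromic_at_global_fixed_point:
  assumes h: "h \<in> \<Gamma>" "h \<notin> exceptional e" "inv h \<notin> exceptional e" "e > 0"
    and q: "h q = q" "d (Inr q) (Inl h) < e"
    and u: "d (Inr u) (Inr q) \<ge> 4 * e" "d (Inr (h u)) (Inr q) \<ge> 4 * e"
  obtains p where "loxodromic_with \<Gamma> h q p" "d (Inr p) (Inr q) \<ge> e"
proof -
  have "d (Inr (h u)) (Inl h) \<ge> e"
    using triangle[of "Inr (h u)" "Inl h" "Inr q"] u(2) q(2) h(1,4) commute[of "Inl h" "Inr q"] by simp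
  then have 1: "d (Inr u) (Inl (inv h)) < e"
    using not_exceptional'[OF h(1,2), of "Inr u"] by simp
  then have 2: "d (Inl (inv h)) (Inr q) > 3 * e"
    using triangle[of "Inr u" "Inl (inv h)" "Inr q"] u(1) h(1) by simp
  then have "d (Inl h) (Inl (inv h)) > 2 * e"
    using triangle[of "Inl (inv h)" "Inl h" "Inr q"] q(2) h(1) commute[of "Inl h" "Inr q"]
      commute[of "Inl h" "Inl (inv h)"] by simp
  then obtain p' q' where pq: "loxodromic_with \<Gamma> h p' q'" "d (Inr p') (Inl h) \<le> e" "d (Inr q') (Inl (inv h)) \<le> e"
    using loxodromic_of_separated[OF h] by blast
  have "q \<noteq> q'" using pq(3) 2 commute[of "Inl (inv h)" "Inr q"] h(4) by auto
  then have "q = p'" using loxodromic_fixed[OF pq(1) q(1)] by blast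
  moreover have "d (Inr q') (Inr q) \<ge> e"
    using triangle[of "Inl (inv h)" "Inr q'" "Inr q"] 2 pq(3) commute[of "Inl (inv h)" "Inr q'"] h(1,4) by simp
  ultimately show ?thesis using that pq(1) by blast
qed

text \<open>A non-exceptional \<open>h\<close> fixing \<open>q\<close> has \<open>q\<close> close to
  \<open>h\<close> or to \<open>inv h\<close>, so \<open>q\<close> attracts under \<open>h\<close>
  or its inverse, and properness applies. Since either may occur, the bound on \<sigma>(h, q) is
  two-sided; passing to the inverse costs \<open>2 * \<kappa>\<close>.\<close>

lemma finite_bounded_at_global_fixed_point:
  assumes fixed: "\<And>f. f \<in> \<Gamma> \<Longrightarrow> f q = q" and "\<delta> > 0"
  shows "finite {h \<in> \<Gamma>. \<bar>\<sigma> h q\<bar> \<le> C \<and> (\<exists>u. d (Inr u) (Inr q) \<ge> \<delta> \<and> d (Inr (h u)) (Inr q) \<ge> \<delta>)}"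
    (is "finite ?S")
proof -
  define e where "e = \<delta> / 4"
  have e: "e > 0" "\<delta> = 4 * e" using assms by (auto simp: e_def)
  define P where "P = {h. \<exists>p' q'. loxodromic_with \<Gamma> h p' q' \<and> d (Inr q') (Inr p') \<ge> e \<and> \<sigma> h p' \<le> C + 2 * \<kappa>}"
  define F where "F = exceptional e \<union> P"
  have "h \<in> F \<union> inv ` F" if "h \<in> ?S" for h
  proof (rule ccontr)
    assume not_in: "h \<notin> F \<union> inv ` F"
    from that obtain u where h: "h \<in> \<Gamma>" "\<bar>\<sigma> h q\<bar> \<le> C"
      and u: "d (Inr u) (Inr q) \<ge> 4 * e" "d (Inr (h u)) (Inr q) \<ge> 4 * e"
      using e(2) by blast
    have "inv h \<notin> F"
    proof
      assume "inv h \<in> F"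
      then have "inv (inv h) \<in> inv ` F" by (rule imageI)
      then show False using not_in h(1) by simp
    qed
    then have *: "h \<notin> exceptional e" "h \<notin> P" "inv h \<notin> exceptional e" "inv h \<notin> P"
      using not_in by (auto simp: F_def)
    show False
    proof (cases "d (Inr q) (Inl h) < e")
      case True
      obtain p where "loxodromic_with \<Gamma> h q p" "d (Inr p) (Inr q) \<ge> e"
        by (rule loxodromic_at_global_fixed_point[OF h(1) *(1,3) e(1) fixed[OF h(1)] True u])
      moreover have "\<sigma> h q \<le> C + 2 * \<kappa>" using h(2) kappa_nonneg by linarith
      ultimately show False using *(2) unfolding P_def by blast
    next
      case False
      then have "d (Inr q) (Inl (inv h)) < e"
        using not_exceptional'[OF h(1) *(1), of "Inr q"] fixed[OF h(1)] by simp
      then obtain p where "loxodromic_with \<Gamma> (inv h) q p" "d (Inr p) (Inr q) \<ge> e"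
        by (rule loxodromic_at_global_fixed_point[of "inv h" e q "h u", rotated 5])
          (use h(1) * e(1) fixed[of "inv h"] u in simp_all)
      moreover have "\<sigma> (inv h) q \<le> C + 2 * \<kappa>"
        using cocycle_inv[OF h(1), of q] h(2) fixed[OF h(1)] by auto
      ultimately show False using *(4) unfolding P_def by blast
    qed
  qed
  then have "?S \<subseteq> F \<union> inv ` F" by blast
  moreover have "finite F"
    unfolding F_def P_def using finite_exceptional[OF e(1)] finite_loxodromic[OF e(1)] by simp
  ultimately show ?thesis by (meson finite_UnI finite_imageI finite_subset)
qed

text \<open>If \<open>q\<close> were fixed by \<open>\<Gamma>\<close>, a sequence tending to another
  limit point would produce a loxodromic \<open>h\<close> with repelling point \<open>q\<close>. Its
  attracting point \<open>p\<close> is then shown to be fixed by \<open>\<Gamma>\<close> as well,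
  and two global fixed points contradict the existence of a third limit point.\<close>

lemma no_global_fixed_point:
  obtains f where "f \<in> \<Gamma>" "f q \<noteq> q"
proof (rule ccontr)
  assume "\<not> thesis"
  then have "\<forall>f\<in>\<Gamma>. f q = q" using that by blast
  then have fixed: "f q = q" if "f \<in> \<Gamma>" for f using that by blast
  obtain a where a: "a \<in> limit_set \<Gamma>" "a \<noteq> q" using three_points by metis
  then obtain y g where g: "range g \<subseteq> \<Gamma>" "conv_loc_unif_off euclidean g y a"
    unfolding limit_set_def by blast
  have lim: "limitin X (\<lambda>n. Inl (g n)) (Inr a) sequentially" using tends_of_conv[OF g(2,1)] .
  have gin: "g n \<in> \<Gamma>" for n using g(1) by auto
  define e where "e = d (Inr a) (Inr q) / 4"
  have e: "e > 0" "d (Inr a) (Inr q) = 4 * e" using d_pos[of "Inr a" "Inr q"] a(2) by (auto simp: e_def)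
  have "\<forall>\<^sub>F n in sequentially. g n \<notin> inv ` exceptional e"
    using eventually_avoids[OF lim] finite_exceptional e(1) by blast
  then have "\<forall>\<^sub>F n in sequentially. \<exists>p. loxodromic_with \<Gamma> (g n) p q"
    using eventually_not_exceptional[OF lim e(1)] tends_D[OF lim e(1)]
  proof eventually_elim
    case (elim n)
    have inv: "inv (g n) \<notin> exceptional e" using elim(1) gin[of n] by (metis image_eqI inv_inv)
    have "d (Inr q) (Inl (g n)) \<ge> e"
      using triangle[of "Inr a" "Inl (g n)" "Inr q"] gin[of n] e elim(3)
        commute[of "Inr a" "Inl (g n)"] commute[of "Inr q" "Inl (g n)"] by simp
    \<comment> \<open>The fixed point \<open>q\<close> is its own image and is far from
      \<open>g n\<close>, so it must be near the inverse.\<close>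
    then have "d (Inr q) (Inl (inv (g n))) < e"
      using not_exceptional'[OF gin elim(2), of "Inr q"] fixed[OF gin] by simp
    then have "d (Inl (g n)) (Inl (inv (g n))) > 2 * e"
      using triangle[of "Inr a" "Inl (g n)" "Inr q"] triangle[of "Inl (g n)" "Inl (inv (g n))" "Inr q"] gin[of n] e elim(3)
        commute[of "Inr a" "Inl (g n)"] commute[of "Inr q" "Inl (inv (g n))"] by simp
    then obtain p q' where pq: "loxodromic_with \<Gamma> (g n) p q'" "d (Inr p) (Inl (g n)) \<le> e"
      using loxodromic_of_separated[OF gin elim(2) inv e(1)] by blast
    have "p \<noteq> q"
      using triangle[of "Inr a" "Inl (g n)" "Inr q"] gin[of n] e elim(3) commute[of "Inr a" "Inl (g n)"]
        commute[of "Inr q" "Inl (g n)"] pq(2) by auto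
    then show ?case using loxodromic_fixed[OF pq(1) fixed[OF gin]] pq(1) by blast
  qed
  then obtain h p where lox: "loxodromic_with \<Gamma> h p q"
    using eventually_happens'[OF sequentially_bot] by blast
  then have h: "h \<in> \<Gamma>" "h p = p" "p \<noteq> q" and conv: "conv_loc_unif_off euclidean (\<lambda>n. h ^^ n) q p"
    unfolding loxodromic_with_def by auto
  have fixed_p: "f p = p" if f: "f \<in> \<Gamma>" for f
  proof (rule ccontr)
    \<comment> \<open>The commutators of the powers of \<open>h\<close> with \<open>f\<close> fix \<open>q\<close>, where \<open>\<sigma>\<close> is a quasimorphism and
      hence bounded on commutators; properness leaves only finitely many of them.\<close>
    assume "f p \<noteq> p"
    define u where "u = f p"
    have "u \<noteq> q" using fixed[OF f] h(3) inv_left[OF f] unfolding u_def by metis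
    define c where "c n = h ^^ n \<circ> (f \<circ> (inv (h ^^ n) \<circ> inv f))" for n
    have c_in: "c n \<in> \<Gamma>" for n using f h(1) by (simp add: c_def)
    have cu: "c n u = (h ^^ n) u" for n
    proof -
      have "inv (h ^^ n) p = p" using h(1) inv_left[of "h ^^ n" p] pow_fixed[of h p n] h(2) by simp
      then show ?thesis using f by (simp add: c_def u_def)
    qed
    \<comment> \<open>The images \<open>c n u\<close> are the points \<open>(h ^^ n) u\<close>,
      which tend to \<open>p\<close>; half the distance from \<open>p\<close> to \<open>q\<close>
      therefore bounds them away from \<open>q\<close>.\<close>
    define \<delta> where "\<delta> = min (d (Inr u) (Inr q)) (d (Inr p) (Inr q) / 2)"
    have dpq: "d (Inr p) (Inr q) / 2 > 0" using d_pos[of "Inr p" "Inr q"] h(3) by simp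
    have \<delta>: "\<delta> > 0" using d_pos[of "Inr u" "Inr q"] dpq \<open>u \<noteq> q\<close> by (simp add: \<delta>_def)
    \<comment> \<open>Splitting the commutator into four factors costs \<open>3 * \<kappa>\<close>,
      and cancelling the two pairs of inverses costs \<open>2 * \<kappa>\<close> each.\<close>
    define S where "S = {k \<in> \<Gamma>. \<bar>\<sigma> k q\<bar> \<le> 7 * \<kappa> \<and> (\<exists>u. d (Inr u) (Inr q) \<ge> \<delta> \<and> d (Inr (k u)) (Inr q) \<ge> \<delta>)}"
    have "finite S" unfolding S_def using fixed by (intro finite_bounded_at_global_fixed_point \<delta>)
    \<comment> \<open>Finitely many values tending to \<open>p\<close> are eventually equal to
      \<open>p\<close>: the complement of the others is a neighbourhood of \<open>p\<close>.\<close>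
    then have "finite ((\<lambda>k. k u) ` S - {p})" by simp
    then have "open (- ((\<lambda>k. k u) ` S - {p}))" by (intro open_Compl finite_imp_closed)
    from conv_loc_unif_off_pointwise[OF conv \<open>u \<noteq> q\<close> this]
    have ev: "\<forall>\<^sub>F n in sequentially. (h ^^ n) u \<in> - ((\<lambda>k. k u) ` S - {p})" by simp
    have quasi: "\<bar>\<sigma> (c n) q\<bar> \<le> 7 * \<kappa>" for n
    proof -
      have hn: "h ^^ n \<in> \<Gamma>" using h(1) by simp
      have "inv (h ^^ n) q = q" "inv f q = q" using fixed hn f by auto
      then show ?thesis
        using cocycle[OF hn, of "f \<circ> (inv (h ^^ n) \<circ> inv f)" q] cocycle[OF f, of "inv (h ^^ n) \<circ> inv f" q]
          cocycle[of "inv (h ^^ n)" "inv f" q] cocycle_inv[OF hn, of q] cocycle_inv[OF f, of q] hn f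
          fixed[OF hn] fixed[OF f]
        by (simp add: c_def)
    qed
    have "\<forall>\<^sub>F n in sequentially. False"
      using ev conv_loc_unif_off_pointwise_d[OF conv \<open>u \<noteq> q\<close> dpq]
    proof eventually_elim
      case (elim n)
      have "d (Inr (c n u)) (Inr q) \<ge> \<delta>"
        using triangle[of "Inr p" "Inr (c n u)" "Inr q"] elim(2) cu[of n] commute[of "Inr p" "Inr (c n u)"]
        by (auto simp: \<delta>_def)
      moreover have "d (Inr u) (Inr q) \<ge> \<delta>" by (simp add: \<delta>_def)
      ultimately have "c n \<in> S" unfolding S_def using quasi c_in by blast
      then have "c n u \<in> (\<lambda>k. k u) ` S" by (rule imageI)
      then have "(h ^^ n) u = p" using elim(1) cu[of n] by auto
      then have "(h ^^ n) u = (h ^^ n) p" using pow_fixed[of h p n] h(2) by simp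
      then have "u = p" using bij_element[OF pow_in[OF h(1)], of n] by (auto simp: bij_def inj_eq)
      then show ?case using \<open>f p \<noteq> p\<close> by (simp add: u_def)
    qed
    then show False by simp
  qed
  obtain b where b: "b \<in> limit_set \<Gamma>" "b \<noteq> p" "b \<noteq> q" using three_points by metis
  then obtain y' k where k: "range k \<subseteq> \<Gamma>" "conv_loc_unif_off euclidean k y' b"
    unfolding limit_set_def by blast
  have limb: "limitin X (\<lambda>n. Inl (k n)) (Inr b) sequentially" using tends_of_conv[OF k(2,1)] .
  have kin: "k n \<in> \<Gamma>" for n using k(1) by auto
  define s where "s = min (d (Inr p) (Inr q)) (min (d (Inr p) (Inr b)) (d (Inr q) (Inr b))) / 2"
  have s: "s > 0" "2 * s \<le> d (Inr p) (Inr q)" "2 * s \<le> d (Inr p) (Inr b)" "2 * s \<le> d (Inr q) (Inr b)"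
    using d_pos[of "Inr p" "Inr q"] d_pos[of "Inr p" "Inr b"] d_pos[of "Inr q" "Inr b"] b h(3)
    by (auto simp: s_def)
  \<comment> \<open>Both \<open>p\<close> and \<open>q\<close> are fixed by \<open>k n\<close> and
    far from \<open>b\<close>, hence both are close to the inverse of \<open>k n\<close>, although
    they are far apart.\<close>
  have "\<forall>\<^sub>F n in sequentially. False"
    using eventually_not_exceptional[OF limb s(1)] tends_D[OF limb s(1)]
  proof eventually_elim
    case (elim n)
    have "d (Inr z) (Inl (inv (k n))) < s" if "k n z = z" "2 * s \<le> d (Inr z) (Inr b)" for z
      using not_exceptional'[OF kin elim(1), of "Inr z"] that
        triangle[of "Inr z" "Inl (k n)" "Inr b"] elim(2) kin[of n] by simp
    from this[OF fixed_p[OF kin] s(3)] this[OF fixed[OF kin] s(4)] show False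
      using triangle[of "Inr p" "Inl (inv (k n))" "Inr q"] s(2) kin[of n] commute[of "Inr q" "Inl (inv (k n))"] by simp
  qed
  then show False by simp
qed

section \<open>Symmetry of \<sigma> and symmetry of the magnitude\<close>

lemma loxodromic_power:
  assumes "h \<in> \<Gamma>" "h p = p"
  shows "\<bar>\<sigma> (h ^^ n) p - real n * \<sigma> h p\<bar> \<le> (real n + 1) * \<kappa>"
proof (induction n)
  case 0
  then show ?case using cocycle_id[of p] by (simp add: id_def)
next
  case (Suc n)
  have "\<bar>\<sigma> (h ^^ Suc n) p - (\<sigma> h p + \<sigma> (h ^^ n) p)\<bar> \<le> \<kappa>"
    using cocycle[OF assms(1) pow_in[OF assms(1)], of n p] pow_fixed[of h p n] assms(2) by simp
  with Suc show ?case unfolding of_nat_Suc by (simp add: algebra_simps del: funpow.simps)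
qed

text \<open>The points \<open>p\<close> and \<open>q\<close> are far from the limits of the inverses
  of the powers of \<open>h\<close> and \<open>inv h\<close>, so \<sigma> at these powers is their
  magnitude up to a constant. That constant depends on \<open>h\<close>, but division by
  \<open>n\<close> removes it; only the part of the error linear in \<open>n\<close> survives, and
  it depends on \<kappa> alone.\<close>

lemma coarsely_symmetric_if:
  assumes D: "\<And>g. g \<in> \<Gamma> \<Longrightarrow> \<bar>mag g - mag (inv g)\<bar> \<le> D"
  shows "coarsely_symmetric \<Gamma> \<sigma>"
proof -
  have "\<bar>\<sigma> h p - \<sigma> (inv h) q\<bar> \<le> 2 * \<kappa> + 1" if lox: "loxodromic_with \<Gamma> h p q" for h p q
  proof -
    have h: "h \<in> \<Gamma>" "h p = p" "p \<noteq> q" "inv h q = q"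
      using lox loxodromic_inv[OF lox] unfolding loxodromic_with_def by auto
    define e where "e = d (Inr p) (Inr q) / 2"
    have e: "e > 0" "d (Inr p) (Inr q) = 2 * e" using d_pos[of "Inr p" "Inr q"] h(3) by (auto simp: e_def)
    obtain C where C: "\<And>x \<gamma>. \<gamma> \<in> \<Gamma> \<Longrightarrow> d (Inr x) (Inl (inv \<gamma>)) > e \<Longrightarrow> \<bar>\<sigma> \<gamma> x - mag \<gamma>\<bar> \<le> C"
      using mag_bound[OF e(1)] by blast
    let ?t = "\<bar>\<sigma> h p - \<sigma> (inv h) q\<bar>"
    have "\<forall>\<^sub>F n in sequentially. real n > max 0 (2 * \<kappa> + 2 * C + D)"
      using filterlim_real_sequentially unfolding filterlim_at_top_dense by blast
    \<comment> \<open>For such \<open>n\<close> all terms not proportional to \<open>n\<close>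
      contribute at most 1 after division.\<close>
    then have "\<forall>\<^sub>F n in sequentially. ?t \<le> 2 * \<kappa> + 1"
      using tends_D[OF loxodromic_tends(1)[OF lox] e(1)] tends_D[OF loxodromic_tends(2)[OF lox] e(1)]
    proof eventually_elim
      case (elim n)
      have "d (Inr p) (Inl (inv (h ^^ n))) > e"
        using triangle[of "Inr p" "Inl (inv h ^^ n)" "Inr q"] elim(3) e(2) h(1) by (simp add: inv_pow)
      then have 1: "\<bar>\<sigma> (h ^^ n) p - mag (h ^^ n)\<bar> \<le> C" using C h(1) by simp
      have "d (Inr q) (Inl (inv (inv h ^^ n))) > e"
        using triangle[of "Inr p" "Inl (h ^^ n)" "Inr q"] elim(2) e(2) h(1) inv_pow[of "inv h" n]
          commute[of "Inr p" "Inl (h ^^ n)"] commute[of "Inr q" "Inl (h ^^ n)"] by simp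
      then have 2: "\<bar>\<sigma> (inv h ^^ n) q - mag (inv h ^^ n)\<bar> \<le> C" using C h(1) by simp
      have 3: "\<bar>mag (h ^^ n) - mag (inv h ^^ n)\<bar> \<le> D" using D[of "h ^^ n"] h(1) by (simp add: inv_pow)
      have n: "real n > 0" "2 * \<kappa> + 2 * C + D \<le> real n" using elim(1) by auto
      have "\<bar>real n * \<sigma> h p - real n * \<sigma> (inv h) q\<bar> \<le> 2 * ((real n + 1) * \<kappa>) + 2 * C + D"
        using loxodromic_power[OF h(1,2), of n] loxodromic_power[OF inv_in[OF h(1)] h(4), of n] 1 2 3 by linarith
      also have "\<dots> \<le> real n * (2 * \<kappa> + 1)" using n(2) by (simp add: algebra_simps)
      finally have "real n * ?t \<le> real n * (2 * \<kappa> + 1)"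
        by (simp add: abs_mult flip: right_diff_distrib)
      then show ?case using n(1) by simp
    qed
    then show ?thesis by simp
  qed
  then show ?thesis
    unfolding coarsely_symmetric_def bdd_above_def by (intro exI[of _ "2 * \<kappa> + 1"]) blast
qed

lemma mag_symmetric_separated:
  assumes "coarsely_symmetric \<Gamma> \<sigma>" "\<epsilon> > 0"
  obtains C where "\<And>h. h \<in> \<Gamma> \<Longrightarrow> d (Inl h) (Inl (inv h)) \<ge> \<epsilon> \<Longrightarrow> \<bar>mag h - mag (inv h)\<bar> \<le> C"
proof -
  obtain D where "\<forall>t\<in>{\<bar>\<sigma> \<gamma> p - \<sigma> (inv \<gamma>) q\<bar> | \<gamma> p q. loxodromic_with \<Gamma> \<gamma> p q}. t \<le> D"
    using assms(1) unfolding coarsely_symmetric_def bdd_above_def by blast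
  then have D: "\<bar>\<sigma> \<gamma> p - \<sigma> (inv \<gamma>) q\<bar> \<le> D" if "loxodromic_with \<Gamma> \<gamma> p q" for \<gamma> p q
    using that by blast
  define e where "e = \<epsilon> / 4"
  have e: "e > 0" "\<epsilon> = 4 * e" using assms(2) by (auto simp: e_def)
  obtain C where C: "\<And>x \<gamma>. \<gamma> \<in> \<Gamma> \<Longrightarrow> d (Inr x) (Inl (inv \<gamma>)) > e \<Longrightarrow> \<bar>\<sigma> \<gamma> x - mag \<gamma>\<bar> \<le> C"
    using mag_bound[OF e(1)] by blast
  define K where "K = (\<Sum>h\<in>exceptional e. \<bar>mag h - mag (inv h)\<bar>)"
  have K: "\<bar>mag h - mag (inv h)\<bar> \<le> K" if "h \<in> exceptional e" for h
    unfolding K_def by (rule member_le_sum[OF that]) (auto simp: finite_exceptional e)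
  have "\<bar>mag h - mag (inv h)\<bar> \<le> max K (2 * C + D)"
    if h: "h \<in> \<Gamma>" "d (Inl h) (Inl (inv h)) \<ge> \<epsilon>" for h
  proof (cases "h \<in> exceptional e \<or> inv h \<in> exceptional e")
    case True
    then have "\<bar>mag h - mag (inv h)\<bar> \<le> K"
      using K[of h] K[of "inv h"] h(1) by auto
    then show ?thesis by simp
  next
    case False
    then obtain p q where pq: "loxodromic_with \<Gamma> h p q" "d (Inr p) (Inl h) \<le> e" "d (Inr q) (Inl (inv h)) \<le> e"
      using loxodromic_of_separated[of h e] h e by auto
    have "d (Inr p) (Inl (inv h)) > e"
      using triangle[of "Inl h" "Inr p" "Inl (inv h)"] pq(2) h e commute[of "Inl h" "Inr p"] by simp
    moreover have "d (Inr q) (Inl (inv (inv h))) > e"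
      using triangle[of "Inl h" "Inr q" "Inl (inv h)"] pq(3) h e commute[of "Inl h" "Inr q"] by simp
    ultimately show ?thesis
      using C[OF h(1), of p] C[OF inv_in[OF h(1)], of q] D[OF pq(1)] by linarith
  qed
  then show ?thesis using that by blast
qed

text \<open>The element used to separate a group element from its inverse depends on where they
  accumulate, and so do the constants. Compactness handles this: along a sequence of unbounded
  asymmetry with convergent inverses, one fixed element suffices.\<close>

lemma mag_symmetric:
  assumes sym: "coarsely_symmetric \<Gamma> \<sigma>"
  obtains D where "\<And>g. g \<in> \<Gamma> \<Longrightarrow> \<bar>mag g - mag (inv g)\<bar> \<le> D"
proof (rule ccontr)
  assume "\<not> thesis"
  then have "\<exists>g\<in>\<Gamma>. \<bar>mag g - mag (inv g)\<bar> > real n" for n using that[of "real n"] by (meson not_le)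
  then obtain g where g: "\<And>n. g n \<in> \<Gamma>" "\<And>n. \<bar>mag (g n) - mag (inv (g n))\<bar> > real n" by metis
  obtain a r where r: "a \<in> B" "strict_mono r" "limitin X (\<lambda>n. Inl (g (r n))) a sequentially"
    using convergent_subsequence[of "\<lambda>n. Inl (g n)"] g(1) by auto
  obtain b s where s: "b \<in> B" "strict_mono s" "limitin X (\<lambda>n. Inl (inv (g (r (s n))))) b sequentially"
    using convergent_subsequence[of "\<lambda>n. Inl (inv (g (r n)))"] g(1) by auto
  define h where "h n = g (r (s n))" for n
  have h: "h n \<in> \<Gamma>" for n using g(1) by (simp add: h_def)
  have large: "\<bar>mag (h n) - mag (inv (h n))\<bar> > real n" for n
  proof -
    have "n \<le> r (s n)" using seq_suble[OF r(2)] seq_suble[OF s(2)] le_trans by blast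
    then show ?thesis using g(2)[of "r (s n)"] by (simp add: h_def)
  qed
  have not_bounded: False if "\<forall>\<^sub>F n in sequentially. \<bar>mag (h n) - mag (inv (h n))\<bar> \<le> K" for K
  proof -
    have "\<forall>\<^sub>F n in sequentially. real n > K"
      using filterlim_real_sequentially unfolding filterlim_at_top_dense by blast
    with that have "\<forall>\<^sub>F n in sequentially. False"
      by eventually_elim (use large in \<open>smt (verit)\<close>)
    then show False by simp
  qed
  have ha: "limitin X (\<lambda>n. Inl (h n)) a sequentially" using tends_subseq[OF r(3) s(2)] by (simp add: h_def)
  have hb: "limitin X (\<lambda>n. Inl (inv (h n))) b sequentially" using s(3) by (simp add: h_def)
  \<comment> \<open>Stated for a left factor \<open>f\<close> because it is used twice: with
    \<open>id\<close> to force equal limits, then with an element moving the common limit. The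
    factor \<open>f\<close> changes the two magnitudes by at most \<open>C1\<close> and
    \<open>C2\<close>.\<close>
  have separated: False
    if f: "f \<in> \<Gamma>" and a': "limitin X (\<lambda>n. Inl (f \<circ> h n)) a' sequentially"
      and b': "limitin X (\<lambda>n. Inl (inv (f \<circ> h n))) b' sequentially" and ne: "a' \<noteq> b'" for f a' b'
  proof -
    define \<epsilon> where "\<epsilon> = d a' b' / 3"
    have B: "a' \<in> B" "b' \<in> B" using a' b' by (auto simp: tends_metric)
    have \<epsilon>: "\<epsilon> > 0" "d a' b' = 3 * \<epsilon>" using d_pos[OF B ne] by (auto simp: \<epsilon>_def)
    obtain C where C: "\<And>k. k \<in> \<Gamma> \<Longrightarrow> d (Inl k) (Inl (inv k)) \<ge> \<epsilon> \<Longrightarrow> \<bar>mag k - mag (inv k)\<bar> \<le> C"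
      using mag_symmetric_separated[OF sym \<epsilon>(1)] by blast
    obtain C1 where C1: "\<And>k. k \<in> \<Gamma> \<Longrightarrow> \<bar>mag (f \<circ> k) - mag k\<bar> \<le> C1" using mag_comp_left[OF f] by blast
    obtain C2 where C2: "\<And>k. k \<in> \<Gamma> \<Longrightarrow> \<bar>mag (k \<circ> inv f) - mag k\<bar> \<le> C2"
      using mag_comp_right[OF inv_in[OF f]] by blast
    have "\<forall>\<^sub>F n in sequentially. \<bar>mag (h n) - mag (inv (h n))\<bar> \<le> C + C1 + C2"
      using tends_D[OF a' \<epsilon>(1)] tends_D[OF b' \<epsilon>(1)]
    proof eventually_elim
      case (elim n)
      have "f \<circ> h n \<in> \<Gamma>" using f h by simp
      then have "d (Inl (f \<circ> h n)) (Inl (inv (f \<circ> h n))) \<ge> \<epsilon>"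
        using triangle[of a' "Inl (f \<circ> h n)" b'] triangle[of "Inl (f \<circ> h n)" "Inl (inv (f \<circ> h n))" b'] elim \<epsilon>(2) B
          commute[of a' "Inl (f \<circ> h n)"] by simp
      from C[OF \<open>f \<circ> h n \<in> \<Gamma>\<close> this] C1[OF h[of n]] C2[OF inv_in[OF h[of n]]]
      show ?case using inv_comp[OF f h[of n]] by simp
    qed
    then show False by (rule not_bounded)
  qed
  have "a = b" using separated[of id a b] ha hb by auto
  show False
  proof (cases a)
    case (Inl \<alpha>)
    then have "\<alpha> \<in> \<Gamma>" using r(1) by simp
    then obtain t where t: "t > 0" "\<And>z. z \<in> B \<Longrightarrow> z \<noteq> Inl \<alpha> \<Longrightarrow> d (Inl \<alpha>) z \<ge> t"
      using isolated by blast
    have "\<forall>\<^sub>F n in sequentially. \<bar>mag (h n) - mag (inv (h n))\<bar> \<le> \<bar>mag \<alpha> - mag (inv \<alpha>)\<bar>"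
      using tends_D[OF ha t(1)]
    proof eventually_elim
      case (elim n)
      then have "h n = \<alpha>" using t(2)[of "Inl (h n)"] h[of n] Inl commute[of a "Inl (h n)"] by force
      then show ?case by simp
    qed
    then show False by (rule not_bounded)
  next
    case (Inr x)
    obtain f where f: "f \<in> \<Gamma>" "f x \<noteq> x" using no_global_fixed_point by blast
    \<comment> \<open>Left multiplication by \<open>f\<close> moves the limit of \<open>h n\<close>
      to \<open>f x\<close>; the inverse is changed only by a right factor and still tends to
      \<open>x\<close>.\<close>
    have "limitin X (\<lambda>n. Inl (f \<circ> h n)) (Inr (f x)) sequentially"
      using tends_act[OF f(1) ha] Inr by simp
    moreover have "limitin X (\<lambda>n. Inl (inv (f \<circ> h n))) (Inr x) sequentially"
      using tends_comp_right[OF inv_in[OF h] _ inv_in[OF f(1)], where x = x] hb Inr \<open>a = b\<close> inv_comp[OF f(1) h] by simp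
    ultimately show False using separated[OF f(1)] f(2) by blast
  qed
qed

section \<open>The coarse GPS system\<close>

abbreviation gromov :: "('a \<Rightarrow> 'a) \<Rightarrow> ('a \<Rightarrow> 'a) \<Rightarrow> real" where
  "gromov \<alpha> \<beta> \<equiv> mag \<alpha> + mag (inv \<beta>) - mag (inv \<beta> \<circ> \<alpha>)"

abbreviation G :: "'a \<times> 'a \<Rightarrow> ereal" where "G \<equiv> gromov_limsup \<Gamma> d mag"

lemma G_eq: "G (x, y) = Limsup (tending_to \<Gamma> d x \<times>\<^sub>F tending_to \<Gamma> d y) (\<lambda>z. ereal (gromov (fst z) (snd z)))"
  by (simp add: gromov_limsup_def case_prod_unfold)

lemma G_bounded:
  assumes "\<delta> > 0"
  obtains C where "\<And>x y. tending_to \<Gamma> d x \<noteq> bot \<Longrightarrow> tending_to \<Gamma> d y \<noteq> bot \<Longrightarrow>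
    d (Inr x) (Inr y) > \<delta> \<Longrightarrow> \<bar>G (x, y)\<bar> \<le> ereal C"
proof -
  obtain C where C: "\<And>a b. a \<in> \<Gamma> \<Longrightarrow> b \<in> \<Gamma> \<Longrightarrow> d (Inl a) (Inl (inv b)) \<ge> \<delta> \<Longrightarrow>
    \<bar>mag a + mag b - mag (b \<circ> a)\<bar> \<le> C"
    using mag_comp_separated[OF assms] by blast
  have "\<bar>G (x, y)\<bar> \<le> ereal C"
    if nt: "tending_to \<Gamma> d x \<noteq> bot" "tending_to \<Gamma> d y \<noteq> bot" and xy: "d (Inr x) (Inr y) > \<delta>" for x y
  proof -
    let ?T = "tending_to \<Gamma> d x \<times>\<^sub>F tending_to \<Gamma> d y"
    \<comment> \<open>Half the excess over \<delta>, so that elements within \<open>r\<close> of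
      \<open>x\<close> and \<open>y\<close> are still \<delta>-separated.\<close>
    define r where "r = (d (Inr x) (Inr y) - \<delta>) / 2"
    have r: "r > 0" "d (Inr x) (Inr y) = 2 * r + \<delta>" using xy by (auto simp: r_def field_simps)
    have "\<forall>\<^sub>F \<alpha> in tending_to \<Gamma> d z. \<alpha> \<in> \<Gamma> \<and> d (Inr z) (Inl \<alpha>) < r" for z
      unfolding eventually_tending_to using r(1) by blast
    from eventually_prodI[OF this this]
    have ev: "\<forall>\<^sub>F z in ?T. \<bar>gromov (fst z) (snd z)\<bar> \<le> C"
    proof eventually_elim
      case (elim z)
      let ?a = "fst z" and ?b = "snd z"
      have "d (Inl ?a) (Inl ?b) \<ge> \<delta>"
        using triangle[of "Inr x" "Inl ?a" "Inr y"] triangle[of "Inl ?a" "Inl ?b" "Inr y"] elim r(2)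
          commute[of "Inr y" "Inl ?b"] by simp
      then show ?case using C[of ?a "inv ?b"] elim by simp
    qed
    have "G (x, y) \<le> ereal C"
      unfolding G_eq by (rule Limsup_bounded, rule eventually_mono[OF ev]) auto
    moreover have "ereal (- C) \<le> Liminf ?T (\<lambda>z. ereal (gromov (fst z) (snd z)))"
      by (rule Liminf_bounded, rule eventually_mono[OF ev]) auto
    \<comment> \<open>Over a trivial filter the limsup would be minus infinity; this is where
      nontriviality enters.\<close>
    moreover have "\<dots> \<le> G (x, y)"
      unfolding G_eq using nt by (intro Liminf_le_Limsup) (simp add: prod_filter_eq_bot)
    ultimately have "ereal (- C) \<le> G (x, y)" "G (x, y) \<le> ereal C" by auto
    then show ?thesis by (cases "G (x, y)") auto
  qed
  then show ?thesis using that by blast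
qed

lemma G_finite:
  assumes "tending_to \<Gamma> d x \<noteq> bot" "tending_to \<Gamma> d y \<noteq> bot" "x \<noteq> y"
  shows "\<bar>G (x, y)\<bar> \<noteq> \<infinity>"
proof -
  have pos: "d (Inr x) (Inr y) / 2 > 0" "d (Inr x) (Inr y) / 2 < d (Inr x) (Inr y)"
    using d_pos[of "Inr x" "Inr y"] assms(3) by auto
  obtain C where "\<And>x' y'. tending_to \<Gamma> d x' \<noteq> bot \<Longrightarrow> tending_to \<Gamma> d y' \<noteq> bot \<Longrightarrow>
    d (Inr x') (Inr y') > d (Inr x) (Inr y) / 2 \<Longrightarrow> \<bar>G (x', y')\<bar> \<le> ereal C"
    using G_bounded[OF pos(1)] by blast
  from this[OF assms(1,2) pos(2)] show ?thesis by auto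
qed

text \<open>Left multiplication by \<gamma> cancels in the product
  \<open>inv \<beta> \<circ> \<alpha>\<close> and sends pairs tending to (x, y) to pairs tending to
  the translated pair, whose limsup therefore dominates. Replacing the magnitude of
  \<open>inv \<beta>\<close> by that of \<beta>, before and after translation, costs
  \<open>2 * D\<close> and makes \<open>mag_comp_near_limit\<close> applicable to both
  variables.\<close>

lemma G_act_ge:
  assumes D: "\<And>g. g \<in> \<Gamma> \<Longrightarrow> \<bar>mag g - mag (inv g)\<bar> \<le> D"
  obtains C where "\<And>\<gamma> x y R L. \<gamma> \<in> \<Gamma> \<Longrightarrow> G (x, y) = ereal R \<Longrightarrow> G (\<gamma> x, \<gamma> y) = ereal L \<Longrightarrow>
    R + \<sigma> \<gamma> x + \<sigma> \<gamma> y \<le> L + C"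
proof -
  obtain C where C: "\<And>\<gamma> x. \<gamma> \<in> \<Gamma> \<Longrightarrow> \<exists>r>0. \<forall>\<alpha>\<in>\<Gamma>. d (Inr x) (Inl \<alpha>) < r \<longrightarrow>
    \<bar>mag (\<gamma> \<circ> \<alpha>) - mag \<alpha> - \<sigma> \<gamma> x\<bar> \<le> C"
    using mag_comp_near_limit by blast
  have "R + \<sigma> \<gamma> x + \<sigma> \<gamma> y \<le> L + (2 * C + 2 * D)"
    if \<gamma>: "\<gamma> \<in> \<Gamma>" and R: "G (x, y) = ereal R" and L: "G (\<gamma> x, \<gamma> y) = ereal L" for \<gamma> x y R L
  proof (rule field_le_epsilon)
    fix e :: real assume "e > 0"
    let ?T = "tending_to \<Gamma> d x \<times>\<^sub>F tending_to \<Gamma> d y"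
    let ?T' = "tending_to \<Gamma> d (\<gamma> x) \<times>\<^sub>F tending_to \<Gamma> d (\<gamma> y)"
    have lim: "filterlim (\<lambda>z. (\<gamma> \<circ> fst z, \<gamma> \<circ> snd z)) ?T' ?T"
      by (intro filterlim_Pair filterlim_compose[OF tending_to_act[OF \<gamma>]] filterlim_fst filterlim_snd)
    have "G (\<gamma> x, \<gamma> y) < ereal (L + e)" using L \<open>e > 0\<close> by simp
    then have "\<forall>\<^sub>F z in ?T'. ereal (gromov (fst z) (snd z)) < ereal (L + e)"
      unfolding G_eq by (rule Limsup_lessD)
    then have 1: "\<forall>\<^sub>F z in ?T. gromov (\<gamma> \<circ> fst z) (\<gamma> \<circ> snd z) < L + e"
      using lim unfolding filterlim_iff by fastforce
    have near: "\<forall>\<^sub>F \<alpha> in tending_to \<Gamma> d z. \<alpha> \<in> \<Gamma> \<and> \<bar>mag (\<gamma> \<circ> \<alpha>) - mag \<alpha> - \<sigma> \<gamma> z\<bar> \<le> C" for z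
      unfolding eventually_tending_to using C[OF \<gamma>, of z] by blast
    have "\<forall>\<^sub>F z in ?T. ereal (gromov (fst z) (snd z)) \<le> ereal (L + e + 2 * C + 2 * D - \<sigma> \<gamma> x - \<sigma> \<gamma> y)"
      using 1 eventually_prodI[OF near[of x] near[of y]]
    proof eventually_elim
      case (elim z)
      let ?a = "fst z" and ?b = "snd z"
      have "inv (\<gamma> \<circ> ?b) \<circ> (\<gamma> \<circ> ?a) = inv ?b \<circ> ?a"
        using elim \<gamma> by (simp add: inv_comp comp_assoc)
      moreover have "\<bar>mag ?b - mag (inv ?b)\<bar> \<le> D" "\<bar>mag (\<gamma> \<circ> ?b) - mag (inv (\<gamma> \<circ> ?b))\<bar> \<le> D"
        using D \<gamma> elim by auto
      ultimately show ?case
        using elim unfolding ereal_less_eq by (smt (verit))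
    qed
    then have "G (x, y) \<le> ereal (L + e + 2 * C + 2 * D - \<sigma> \<gamma> x - \<sigma> \<gamma> y)"
      unfolding G_eq by (rule Limsup_bounded)
    then show "R + \<sigma> \<gamma> x + \<sigma> \<gamma> y \<le> L + (2 * C + 2 * D) + e" using R by simp
  qed
  then show ?thesis using that by blast
qed

lemma locally_bounded_G:
  "locally_bounded_on (distinct_pairs (limit_set \<Gamma>)) (\<lambda>z. real_of_ereal (G z))"
  unfolding locally_bounded_on_def
proof
  let ?S = "distinct_pairs (limit_set \<Gamma>)"
  fix z assume z: "z \<in> ?S"
  obtain x y where xy: "z = (x, y)" by fastforce
  then have "x \<noteq> y" using z by (auto simp: distinct_pairs_def)
  define r where "r = d (Inr x) (Inr y) / 4"
  have r: "r > 0" "d (Inr x) (Inr y) = 4 * r" using d_pos[of "Inr x" "Inr y"] \<open>x \<noteq> y\<close> by (auto simp: r_def)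
  obtain C where C: "\<And>x y. tending_to \<Gamma> d x \<noteq> bot \<Longrightarrow> tending_to \<Gamma> d y \<noteq> bot \<Longrightarrow>
    d (Inr x) (Inr y) > r \<Longrightarrow> \<bar>G (x, y)\<bar> \<le> ereal C"
    using G_bounded[OF r(1)] by blast
  let ?U = "?S \<inter> ({u. d (Inr u) (Inr x) < r} \<times> {v. d (Inr v) (Inr y) < r})"
  have "openin (top_of_set ?S) ?U"
    by (intro openin_open_Int open_Times ball_M)
  moreover have "z \<in> ?U" using z xy r(1) by simp
  moreover have "bounded ((\<lambda>z. real_of_ereal (G z)) ` ?U)"
    unfolding bounded_iff
  proof (intro exI[of _ C] ballI)
    fix t assume "t \<in> (\<lambda>z. real_of_ereal (G z)) ` ?U"
    then obtain u v where uv: "t = real_of_ereal (G (u, v))" "u \<in> limit_set \<Gamma>" "v \<in> limit_set \<Gamma>"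
      "d (Inr u) (Inr x) < r" "d (Inr v) (Inr y) < r"
      by (auto simp: distinct_pairs_def)
    have "d (Inr u) (Inr v) > r"
      using triangle[of "Inr x" "Inr u" "Inr y"] triangle[of "Inr u" "Inr v" "Inr y"] uv(4,5) r
        commute[of "Inr x" "Inr u"] by simp
    then have "\<bar>G (u, v)\<bar> \<le> ereal C" using C tending_to_nontrivial uv(2,3) by blast
    then show "norm t \<le> C" unfolding uv(1) by (cases "G (u, v)") auto
  qed
  ultimately show "\<exists>U. openin (top_of_set ?S) U \<and> z \<in> U \<and> bounded ((\<lambda>z. real_of_ereal (G z)) ` U)"
    by blast
qed

lemma kappa_coarse_cocycle_restrict:
  assumes "\<kappa> \<le> \<kappa>'"
  shows "kappa_coarse_cocycle \<kappa>' \<Gamma> N \<sigma>"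
  unfolding kappa_coarse_cocycle_def
proof (intro conjI ballI)
  show "\<kappa>' \<ge> 0" using kappa_nonneg assms by simp
  fix \<gamma> x assume *: "\<gamma> \<in> \<Gamma>" "x \<in> N"
  have le: "Limsup (at x) (\<lambda>y. ereal \<bar>\<sigma> \<gamma> x - \<sigma> \<gamma> y\<bar>) \<le> ereal \<kappa>'"
    using coarse * assms unfolding kappa_coarse_cocycle_def by (meson UNIV_I ereal_less_eq(3) order_trans)
  show "Limsup (at x within N) (\<lambda>y. ereal \<bar>\<sigma> \<gamma> x - \<sigma> \<gamma> y\<bar>) \<le> ereal \<kappa>'"
    unfolding Limsup_le_iff
  proof (intro allI impI)
    fix t assume "ereal \<kappa>' < t"
    then have "\<forall>\<^sub>F y in at x. ereal \<bar>\<sigma> \<gamma> x - \<sigma> \<gamma> y\<bar> < t" using le Limsup_lessD order_le_less_trans by blast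
    then show "\<forall>\<^sub>F y in at x within N. ereal \<bar>\<sigma> \<gamma> x - \<sigma> \<gamma> y\<bar> < t" using at_le[of N UNIV x] filter_leD by blast
  qed
next
  fix \<alpha> \<beta> x assume "\<alpha> \<in> \<Gamma>" "\<beta> \<in> \<Gamma>"
  then show "\<bar>\<sigma> (\<alpha> \<circ> \<beta>) x - (\<sigma> \<alpha> (\<beta> x) + \<sigma> \<beta> x)\<bar> \<le> \<kappa>'"
    using cocycle[of \<alpha> \<beta> x] assms by linarith
qed

lemma GPS_system:
  assumes sym: "coarsely_symmetric \<Gamma> \<sigma>"
  shows "coarse_GPS_system \<Gamma> d \<sigma> \<sigma> (\<lambda>z. real_of_ereal (G z))"
proof -
  obtain D where D: "\<And>g. g \<in> \<Gamma> \<Longrightarrow> \<bar>mag g - mag (inv g)\<bar> \<le> D" using mag_symmetric[OF sym] by blast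
  obtain C where C: "\<And>\<gamma> x y R L. \<gamma> \<in> \<Gamma> \<Longrightarrow> G (x, y) = ereal R \<Longrightarrow> G (\<gamma> x, \<gamma> y) = ereal L \<Longrightarrow>
    R + \<sigma> \<gamma> x + \<sigma> \<gamma> y \<le> L + C"
    using G_act_ge[OF D] by blast
  \<comment> \<open>The opposite inequality is \<open>G_act_ge\<close> for
    \<open>inv \<gamma>\<close> at the translated pair; rewriting its two cocycle values in terms of
    \<gamma> costs \<open>2 * \<kappa>\<close> each.\<close>
  define K where "K = \<bar>C\<bar> + 4 * \<kappa>"
  have K: "K \<ge> \<kappa>" "K \<ge> 0" using kappa_nonneg by (auto simp: K_def)
  have "\<bar>(\<sigma> \<gamma> x + \<sigma> \<gamma> y) - (real_of_ereal (G (\<gamma> x, \<gamma> y)) - real_of_ereal (G (x, y)))\<bar> \<le> K"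
    if \<gamma>: "\<gamma> \<in> \<Gamma>" and xy: "x \<in> limit_set \<Gamma>" "y \<in> limit_set \<Gamma>" "x \<noteq> y" for \<gamma> x y
  proof -
    have nt: "tending_to \<Gamma> d x \<noteq> bot" "tending_to \<Gamma> d y \<noteq> bot" using xy tending_to_nontrivial by auto
    have ne: "\<gamma> x \<noteq> \<gamma> y" using bij_element[OF \<gamma>] xy(3) by (auto simp: bij_def inj_eq)
    obtain R where R: "G (x, y) = ereal R" using G_finite[OF nt xy(3)] by auto
    obtain L where L: "G (\<gamma> x, \<gamma> y) = ereal L"
      using G_finite[OF tending_to_act_nontrivial[OF \<gamma> nt(1)] tending_to_act_nontrivial[OF \<gamma> nt(2)] ne] by auto
    have "G (inv \<gamma> (\<gamma> x), inv \<gamma> (\<gamma> y)) = ereal R" using R \<gamma> by simp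
    from C[OF \<gamma> R L] C[OF inv_in[OF \<gamma>] L this] cocycle_inv[OF \<gamma>, of x] cocycle_inv[OF \<gamma>, of y]
    show ?thesis using R L unfolding K_def by simp
  qed
  then show ?thesis
    unfolding coarse_GPS_system_def
    using K kappa_coarse_cocycle_restrict[OF K(1)] proper locally_bounded_G
    by (intro exI[of _ K]) (auto simp: distinct_pairs_def)
qed

end

text \<open>The limsup is an extended real and \<open>real_of_ereal\<close> sends infinite values to
  0; the finiteness clause ensures that the GPS function is the actual limsup on distinct pairs of
  limit points.\<close>

theorem proposition15p1:
  fixes \<Gamma> :: "('a::metric_space \<Rightarrow> 'a) set"
    and d :: "('a \<Rightarrow> 'a) + 'a \<Rightarrow> ('a \<Rightarrow> 'a) + 'a \<Rightarrow> real"
    and \<sigma> :: "('a \<Rightarrow> 'a) \<Rightarrow> 'a \<Rightarrow> real"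
    and mag :: "('a \<Rightarrow> 'a) \<Rightarrow> real"
  assumes "compact (UNIV :: 'a set)"
    and "convergence_group \<Gamma>"
    and "non_elementary \<Gamma>"
    and "compatible_metric \<Gamma> d"
    and "expanding_coarse_cocycle \<Gamma> d \<sigma>"
    and "magnitude \<Gamma> d \<sigma> mag"
  shows "(coarsely_symmetric \<Gamma> \<sigma> \<longleftrightarrow> bdd_above ((\<lambda>\<gamma>. \<bar>mag \<gamma> - mag (inv \<gamma>)\<bar>) ` \<Gamma>)) \<and>
    (coarsely_symmetric \<Gamma> \<sigma> \<longrightarrow>
       (\<forall>z \<in> distinct_pairs (limit_set \<Gamma>). \<bar>gromov_limsup \<Gamma> d mag z\<bar> \<noteq> \<infinity>) \<and>
       coarse_GPS_system \<Gamma> d \<sigma> \<sigma> (\<lambda>z. real_of_ereal (gromov_limsup \<Gamma> d mag z)))"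
proof -
  obtain \<kappa> where "kappa_coarse_cocycle \<kappa> \<Gamma> UNIV \<sigma>" "proper_cocycle \<Gamma> d \<sigma>"
    using assms(5) unfolding expanding_coarse_cocycle_def coarse_cocycle_def by blast
  then interpret expanding_cocycle \<Gamma> d \<sigma> mag \<kappa>
    using assms by unfold_locales
  have "coarsely_symmetric \<Gamma> \<sigma> \<longleftrightarrow> bdd_above ((\<lambda>\<gamma>. \<bar>mag \<gamma> - mag (inv \<gamma>)\<bar>) ` \<Gamma>)"
  proof
    assume "coarsely_symmetric \<Gamma> \<sigma>"
    then obtain D where "\<And>g. g \<in> \<Gamma> \<Longrightarrow> \<bar>mag g - mag (inv g)\<bar> \<le> D" using mag_symmetric by blast
    then show "bdd_above ((\<lambda>\<gamma>. \<bar>mag \<gamma> - mag (inv \<gamma>)\<bar>) ` \<Gamma>)" by (rule bdd_aboveI2)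
  next
    assume "bdd_above ((\<lambda>\<gamma>. \<bar>mag \<gamma> - mag (inv \<gamma>)\<bar>) ` \<Gamma>)"
    then obtain D where "\<forall>g\<in>\<Gamma>. \<bar>mag g - mag (inv g)\<bar> \<le> D" unfolding bdd_above_def by blast
    then show "coarsely_symmetric \<Gamma> \<sigma>" using coarsely_symmetric_if by blast
  qed
  moreover have "\<bar>gromov_limsup \<Gamma> d mag z\<bar> \<noteq> \<infinity>" if z: "z \<in> distinct_pairs (limit_set \<Gamma>)" for z
    using G_finite[of "fst z" "snd z"] tending_to_nontrivial z by (auto simp: distinct_pairs_def)
  moreover note GPS_system
  ultimately show ?thesis by (intro conjI impI ballI)
qed

end
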